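(* Let $k\in\{1,2,3,\ldots\}$ and let $\varphi_k:\mathbb{S}^1\to\mathbb{S}^2\subset\mathbb{R}^3$ be the proper biharmonic map $$\varphi_k(\gamma)=\left(\tfrac{1}{\sqrt2}\cos(k\gamma),\ \tfrac{1}{\sqrt2}\sin(k\gamma),\ \tfrac{1}{\sqrt2}\right),\qquad 0\le\gamma\le2\pi.$$ Then $$\mathrm{Nullity}(\varphi_k)=3,\qquad \mathrm{Index}(\varphi_k)=1+2(k-1).$$
   Context: $\mathbb{S}^1$ is the unit circle with metric $d\gamma^2$ and $\mathbb{S}^2$ is the unit sphere. For a smooth map $\varphi:M\to N$ of Riemannian manifolds, $M$ compact, the tension field is $\tau(\varphi)=\mathrm{trace}\,\nabla d\varphi$, and the bienergy is $E_2(\varphi)=\frac12\int_M|\tau(\varphi)|^2\,dv_M$. Biharmonic maps are the critical points of $E_2$; a biharmonic map is proper if it is not harmonic, i.e. $\tau(\varphi)\not\equiv0$. For a biharmonic map $\varphi$ and a two-parameter smooth variation $\varphi_{t,s}$ with $\varphi_{0,0}=\varphi$, $V=\frac{d}{dt}|_{t=0}\varphi_{t,0}$, $W=\frac{d}{ds}|_{s=0}\varphi_{0,s}$, the Hessian is $H(E_2)_\varphi(V,W)=\frac{\partial^2}{\partial t\partial s}|_{(0,0)}E_2(\varphi_{t,s})=\int_M\langle I_2(V),W\rangle\,dv_M$, where the second variation operator $I_2$ acts on the space $\mathcal{C}(\varphi^{-1}TN)$ of smooth sections of the pull-back bundle $\varphi^{-1}TN$. When $N=\mathbb{S}^n$ is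 the unit sphere, with $\{e_i\}$ a local orthonormal frame of $M$, $\nabla^\varphi$ the induced connection on $\varphi^{-1}TN$ and $\overline{\Delta}=-\sum_i(\nabla^\varphi_{e_i}\nabla^\varphi_{e_i}-\nabla^\varphi_{\nabla^M_{e_i}e_i})$, it is $$\begin{aligned}I_2(V)=\ &\overline{\Delta}^2V+\overline{\Delta}\big(T(V)-|d\varphi|^2V\big)+2\langle d\tau(\varphi),d\varphi\rangle V+|\tau(\varphi)|^2V-2\sum_i\langle V,\nabla^\varphi_{e_i}\tau(\varphi)\rangle d\varphi(e_i)\\&-2\sum_i\langle\tau(\varphi),\nabla^\varphi_{e_i}V\rangle d\varphi(e_i)-\langle\tau(\varphi),V\rangle\tau(\varphi)+T(\overline{\Delta}V)+T(T(V))-2|d\varphi|^2T(V)\\&+2\langle dV,d\varphi\rangle\tau(\varphi)-|d\varphi|^2\overline{\Delta}V+|d\varphi|^4V,\end{aligned}$$ where $T(V)=\sum_i\langle V,d\varphi(e_i)\rangle d\varphi(e_i)$, $\langle d\tau(\varphi),d\varphi\rangle=\sum_i\langle\nabla^\varphi_{e_i}\tau(\varphi),d\varphi(e_i)\rangle$ and $\langle dV,d\varphi\rangle=\sum_i\langle\nabla^\varphi_{e_i}V,d\varphi(e_i)\rangle$. Since $M$ is compact, $I_2$ has discrete spectrum $\lambda_1<\lambda_2<\cdots\to+\infty$ with finite-dimensional eigenspaces $\mathcal{V}_i$. Then $\mathrm{Index}(\varphi)=\sum_{\lambda_i<0}\dim\mathcal{V}_i$ and $\mathrm{Nullity}(\varphi)=\dim\{V\in\mathcal{C}(\varphi^{-1}TN):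 I_2(V)=0\}$. *)

theory Defs
  imports "HOL-Analysis.Analysis" "HOL-Library.Function_Algebras" "HOL-Library.Extended_Nat"
begin

text \<open>Functions and vector fields on the unit circle with metric \<open>d\<gamma>\<^sup>2\<close> are represented by
  \<open>2\<pi>\<close>-periodic functions of the angle \<open>\<gamma>\<close>, and the unit sphere by the vectors of norm 1 in
  a Euclidean space \<open>'a\<close>.  The orthonormal frame of the circle is the single field
  \<open>e = d/d\<gamma>\<close>, for which the Levi-Civita derivative of \<open>e\<close> along \<open>e\<close> vanishes; hence sums
  over a frame have one term.\<close>

text \<open>Smoothness: all iterated directional derivatives exist and are Frechet differentiable
  (hence continuous) on the whole space.\<close>

coinductive smooth :: "('a::euclidean_space \<Rightarrow> 'b::real_normed_vector) \<Rightarrow> bool" where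
  "(\<forall>x. f differentiable (at x)) \<Longrightarrow> (\<forall>v. smooth (\<lambda>x. frechet_derivative f (at x) v)) \<Longrightarrow> smooth f"

definition periodic :: "(real \<Rightarrow> 'b) \<Rightarrow> bool" where
  "periodic f \<longleftrightarrow> (\<forall>\<gamma>. f (\<gamma> + 2 * pi) = f \<gamma>)"

definition circle_sphere_map :: "(real \<Rightarrow> 'a::euclidean_space) \<Rightarrow> bool" where
  "circle_sphere_map \<phi> \<longleftrightarrow> smooth \<phi> \<and> periodic \<phi> \<and> (\<forall>\<gamma>. \<phi> \<gamma> \<in> sphere 0 1)"

text \<open>Smooth sections of the pull-back bundle; the tangent space of the unit sphere at \<open>p\<close> is the
  orthogonal complement of \<open>p\<close>.\<close>

definition sections :: "(real \<Rightarrow> 'a::euclidean_space) \<Rightarrow> (real \<Rightarrow> 'a) set" where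
  "sections \<phi> = {V. smooth V \<and> periodic V \<and> (\<forall>\<gamma>. V \<gamma> \<bullet> \<phi> \<gamma> = 0)}"

text \<open>\<open>d\<phi>(e)\<close>\<close>

definition diff_e :: "(real \<Rightarrow> 'a::euclidean_space) \<Rightarrow> real \<Rightarrow> 'a" where
  "diff_e \<phi> \<gamma> = vector_derivative \<phi> (at \<gamma>)"

text \<open>The induced connection in direction \<open>e\<close>: the Levi-Civita connection of the sphere is the
  tangential part of the derivative in the ambient space.\<close>

definition nabla :: "(real \<Rightarrow> 'a::euclidean_space) \<Rightarrow> (real \<Rightarrow> 'a) \<Rightarrow> real \<Rightarrow> 'a" where
  "nabla \<phi> V \<gamma> = vector_derivative V (at \<gamma>) - (vector_derivative V (at \<gamma>) \<bullet> \<phi> \<gamma>) *\<^sub>R \<phi> \<gamma>"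

definition tension :: "(real \<Rightarrow> 'a::euclidean_space) \<Rightarrow> real \<Rightarrow> 'a" where
  "tension \<phi> = nabla \<phi> (diff_e \<phi>)"

definition bienergy :: "(real \<Rightarrow> 'a::euclidean_space) \<Rightarrow> real" where
  "bienergy \<phi> = 1 / 2 * integral {0..2 * pi} (\<lambda>\<gamma>. (norm (tension \<phi> \<gamma>))\<^sup>2)"

text \<open>Critical points of the bienergy.  Taking the parameter \<open>t\<close> of a variation in all of the reals
  rather than in an interval around 0 is no restriction: reparametrise by a diffeomorphism from the
  reals to the interval that fixes 0 and has derivative 1 there.\<close>

definition variation :: "(real \<Rightarrow> 'a::euclidean_space) \<Rightarrow> (real \<times> real \<Rightarrow> 'a) \<Rightarrow> bool" where
  "variation \<phi> \<Phi> \<longleftrightarrow> smooth \<Phi> \<and> (\<forall>t. circle_sphere_map (\<lambda>\<gamma>. \<Phi> (t, \<gamma>))) \<and> (\<forall>\<gamma>. \<Phi> (0, \<gamma>) = \<phi> \<gamma>)"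

definition biharmonic :: "(real \<Rightarrow> 'a::euclidean_space) \<Rightarrow> bool" where
  "biharmonic \<phi> \<longleftrightarrow> circle_sphere_map \<phi> \<and>
     (\<forall>\<Phi>. variation \<phi> \<Phi> \<longrightarrow>
        ((\<lambda>t. bienergy (\<lambda>\<gamma>. \<Phi> (t, \<gamma>))) has_real_derivative 0) (at 0))"

definition proper_biharmonic :: "(real \<Rightarrow> 'a::euclidean_space) \<Rightarrow> bool" where
  "proper_biharmonic \<phi> \<longleftrightarrow> biharmonic \<phi> \<and> (\<exists>\<gamma>. tension \<phi> \<gamma> \<noteq> 0)"

definition rough_laplacian :: "(real \<Rightarrow> 'a::euclidean_space) \<Rightarrow> (real \<Rightarrow> 'a) \<Rightarrow> real \<Rightarrow> 'a" where
  "rough_laplacian \<phi> V \<gamma> = - nabla \<phi> (nabla \<phi> V) \<gamma>"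

definition T_op :: "(real \<Rightarrow> 'a::euclidean_space) \<Rightarrow> (real \<Rightarrow> 'a) \<Rightarrow> real \<Rightarrow> 'a" where
  "T_op \<phi> V \<gamma> = (V \<gamma> \<bullet> diff_e \<phi> \<gamma>) *\<^sub>R diff_e \<phi> \<gamma>"

text \<open>\<open>|d\<phi>|\<^sup>2\<close>, and \<open>\<langle>dV, d\<phi>\<rangle>\<close> for a section \<open>V\<close>\<close>

definition diff_sq :: "(real \<Rightarrow> 'a::euclidean_space) \<Rightarrow> real \<Rightarrow> real" where
  "diff_sq \<phi> \<gamma> = (norm (diff_e \<phi> \<gamma>))\<^sup>2"

definition diff_inner :: "(real \<Rightarrow> 'a::euclidean_space) \<Rightarrow> (real \<Rightarrow> 'a) \<Rightarrow> real \<Rightarrow> real" where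
  "diff_inner \<phi> V \<gamma> = nabla \<phi> V \<gamma> \<bullet> diff_e \<phi> \<gamma>"

text \<open>The second variation operator of the bienergy for maps into the unit sphere\<close>

definition I2 :: "(real \<Rightarrow> 'a::euclidean_space) \<Rightarrow> (real \<Rightarrow> 'a) \<Rightarrow> real \<Rightarrow> 'a" where
  "I2 \<phi> V \<gamma> =
     rough_laplacian \<phi> (rough_laplacian \<phi> V) \<gamma>
     + rough_laplacian \<phi> (\<lambda>\<gamma>. T_op \<phi> V \<gamma> - diff_sq \<phi> \<gamma> *\<^sub>R V \<gamma>) \<gamma>
     + (2 * diff_inner \<phi> (tension \<phi>) \<gamma>) *\<^sub>R V \<gamma>
     + (norm (tension \<phi> \<gamma>))\<^sup>2 *\<^sub>R V \<gamma>
     - (2 * (V \<gamma> \<bullet> nabla \<phi> (tension \<phi>) \<gamma>)) *\<^sub>R diff_e \<phi> \<gamma>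
     - (2 * (tension \<phi> \<gamma> \<bullet> nabla \<phi> V \<gamma>)) *\<^sub>R diff_e \<phi> \<gamma>
     - (tension \<phi> \<gamma> \<bullet> V \<gamma>) *\<^sub>R tension \<phi> \<gamma>
     + T_op \<phi> (rough_laplacian \<phi> V) \<gamma>
     + T_op \<phi> (T_op \<phi> V) \<gamma>
     - (2 * diff_sq \<phi> \<gamma>) *\<^sub>R T_op \<phi> V \<gamma>
     + (2 * diff_inner \<phi> V \<gamma>) *\<^sub>R tension \<phi> \<gamma>
     - diff_sq \<phi> \<gamma> *\<^sub>R rough_laplacian \<phi> V \<gamma>
     + (diff_sq \<phi> \<gamma>)\<^sup>2 *\<^sub>R V \<gamma>"

interpretation fun_space: vector_space "\<lambda>(c::real) (f::'a \<Rightarrow> 'b::real_vector) x. c *\<^sub>R f x"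
  by unfold_locales (auto simp: fun_eq_iff scaleR_add_right scaleR_add_left)

text \<open>The dimension of a space of functions, with value \<open>\<infinity>\<close> if it is not finite-dimensional
  (where the library's \<open>dim\<close> is 0 by convention).\<close>

definition edim :: "('a \<Rightarrow> 'b::real_vector) set \<Rightarrow> enat" where
  "edim S = (if \<exists>B. finite B \<and> S \<subseteq> fun_space.span B then enat (fun_space.dim S) else \<infinity>)"

definition eigenspace :: "(real \<Rightarrow> 'a::euclidean_space) \<Rightarrow> real \<Rightarrow> (real \<Rightarrow> 'a) set" where
  "eigenspace \<phi> lam = {V \<in> sections \<phi>. \<forall>\<gamma>. I2 \<phi> V \<gamma> = lam *\<^sub>R V \<gamma>}"

definition eigenvalue :: "(real \<Rightarrow> 'a::euclidean_space) \<Rightarrow> real \<Rightarrow> bool" where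
  "eigenvalue \<phi> lam \<longleftrightarrow> (\<exists>V \<in> eigenspace \<phi> lam. \<exists>\<gamma>. V \<gamma> \<noteq> 0)"

text \<open>If there were infinitely many negative eigenvalues, the sum of the (positive) dimensions would
  be infinite; the case distinction is needed because \<open>sum\<close> over an infinite set is 0.\<close>

definition Index :: "(real \<Rightarrow> 'a::euclidean_space) \<Rightarrow> enat" where
  "Index \<phi> = (if finite {lam. eigenvalue \<phi> lam \<and> lam < 0}
     then \<Sum>lam | eigenvalue \<phi> lam \<and> lam < 0. edim (eigenspace \<phi> lam) else \<infinity>)"

definition Nullity :: "(real \<Rightarrow> 'a::euclidean_space) \<Rightarrow> enat" where
  "Nullity \<phi> = edim {V \<in> sections \<phi>. \<forall>\<gamma>. I2 \<phi> V \<gamma> = 0}"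

definition phi :: "nat \<Rightarrow> real \<Rightarrow> real ^ 3" where
  "phi k \<gamma> = vector [1 / sqrt 2 * cos (real k * \<gamma>), 1 / sqrt 2 * sin (real k * \<gamma>), 1 / sqrt 2]"

end

theory Submission imports Defs begin

text \<open>Along \<open>phi k\<close> the unit tangent field \<open>tangent k\<close> and the unit field \<open>normal k\<close> orthogonal to it form
an orthonormal frame of the pull-back bundle.  It turns at constant speed \<open>m = k / sqrt 2\<close>:
\<open>\<nabla> tangent = - m normal\<close> and \<open>\<nabla> normal = m tangent\<close>.  Hence for \<open>V = f tangent + g normal\<close>
all terms of the second variation operator have constant coefficients, and they collapse to
\<open>(f'''' - 6 m\<^sup>2 f'' + 4 m g''',  g'''' - 4 m f''' - 4 m\<^sup>2 g'' - 4 m\<^sup>4 g)\<close> (\<open>I2_frame_sec\<close>).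

Such an operator is diagonalised by Fourier series.  The real Hartley functions
\<open>cas (j x) = cos (j x) + sin (j x)\<close>, with \<open>j\<close> ranging over all integers, are the convenient basis: they
are orthogonal, and a derivative maps \<open>cas (j x)\<close> to a multiple of \<open>cas (- j x)\<close>.  The operator therefore
preserves the plane of the fields \<open>a cas (j x) tangent + b cas (- j x) normal\<close> for each \<open>j\<close> and acts on
\<open>(a, b)\<close> as the symmetric matrix with entries \<open>j\<^sup>4 + 6 m\<^sup>2 j\<^sup>2\<close>, \<open>4 m j\<^sup>3\<close> and
\<open>j\<^sup>4 + 4 m\<^sup>2 j\<^sup>2 - 4 m\<^sup>4\<close>.  Since \<open>2 m\<^sup>2 = k\<^sup>2\<close>, its determinant is
\<open>j\<^sup>2 (j\<^sup>2 - k\<^sup>2) ((j\<^sup>2 - k\<^sup>2)\<^sup>2 + 2 k\<^sup>4)\<close>.  For \<open>j \<noteq> 0\<close> the larger eigenvalue is positive, so the smaller one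
is negative, zero or positive according to whether \<open>\<bar>j\<bar>\<close> is below, at or above \<open>k\<close>; for \<open>j = 0\<close> the matrix
is diagonal with entries \<open>0\<close> and \<open>- 4 m\<^sup>4\<close>.  So each of the \<open>2 k - 1\<close> integers with \<open>\<bar>j\<bar> < k\<close>
contributes one negative direction, and \<open>j = - k, 0, k\<close> contribute one null direction each.  That there
are no further eigenvectors is the completeness of the Hartley functions
(\<open>hartley_zero_imp_zero\<close>, \<open>eigenspace_waves\<close>), which comes from the Stone-Weierstrass theorem on the circle.

For biharmonicity, a curve on the unit sphere with velocity \<open>A\<close> and acceleration \<open>B\<close> has bienergy
\<open>1/2 \<integral> \<bar>B\<bar>\<^sup>2 - \<bar>A\<bar>\<^sup>4\<close>.  If the speed is constant, \<open>\<bar>A\<bar>\<^sup>2 = s\<close>, and the third derivative is \<open>- 2 s A\<close>, then the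
integrand of the first variation is the derivative of a periodic function
(\<open>constant_speed_biharmonic\<close>), and \<open>phi k\<close> is such a curve with \<open>2 s = k\<^sup>2\<close>.\<close>

section \<open>Smooth functions of one real variable\<close>

text \<open>Membership in the space of \<open>n\<close> times differentiable functions, by recursion on \<open>n\<close>.  Closure under sums
and products is a plain induction here, whereas a direct coinduction on \<open>smooth\<close> would have to
carry the full Leibniz expansion.\<close>

primrec diff_times :: "nat \<Rightarrow> (real \<Rightarrow> 'b::real_normed_vector) \<Rightarrow> bool" where
  "diff_times 0 f \<longleftrightarrow> True"
| "diff_times (Suc n) f \<longleftrightarrow>
     (\<exists>f'. (\<forall>x. (f has_vector_derivative f' x) (at x)) \<and> diff_times n f')"

lemma smooth_imp_vector_derivative:
  fixes f :: "real \<Rightarrow> 'b::real_normed_vector"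
  assumes "smooth f"
  shows "(f has_vector_derivative vector_derivative f (at x)) (at x)"
  using assms by (auto elim: smooth.cases simp: vector_derivative_works[symmetric])

lemma smooth_vector_derivative:
  fixes f :: "real \<Rightarrow> 'b::real_normed_vector"
  assumes "smooth f"
  shows "smooth (\<lambda>x. vector_derivative f (at x))"
proof -
  have "\<And>x. f differentiable (at x)" and "smooth (\<lambda>x. frechet_derivative f (at x) 1)"
    using assms by (auto elim: smooth.cases)
  moreover have "frechet_derivative f (at x) 1 = vector_derivative f (at x)" for x
    using calculation(1)[of x] frechet_derivative_eq_vector_derivative by (metis scaleR_one)
  ultimately show ?thesis by simp
qed

text \<open>For the converse, coinduction must also follow the derivatives in directions \<open>v \<noteq> 1\<close>; on the real
line these are scalar multiples of the ordinary derivative, so the invariant allows a scalar factor.\<close>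

lemma smooth_iff_diff_times:
  fixes f :: "real \<Rightarrow> 'b::real_normed_vector"
  shows "smooth f \<longleftrightarrow> (\<forall>n. diff_times n f)"
proof
  assume "smooth f"
  have "smooth g \<Longrightarrow> diff_times n g" for n and g :: "real \<Rightarrow> 'b"
    by (induction n arbitrary: g)
      (auto intro!: exI[of _ "\<lambda>x. vector_derivative _ (at x)"]
         intro: smooth_imp_vector_derivative smooth_vector_derivative)
  then show "\<forall>n. diff_times n f" using \<open>smooth f\<close> by blast
next
  assume "\<forall>n. diff_times n f"
  then have "\<exists>g c. f = (\<lambda>x. c *\<^sub>R g x) \<and> (\<forall>n. diff_times n g)"
    by (intro exI[of _ f] exI[of _ "1::real"]) auto
  then show "smooth f"
  proof (coinduction arbitrary: f)
    case (smooth f)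
    then obtain g c where f: "f = (\<lambda>x. c *\<^sub>R g x)" and g: "\<And>n. diff_times n g" by auto
    define g' where "g' = (\<lambda>x. vector_derivative g (at x))"
    have eq: "h = g'" if "\<forall>x. (g has_vector_derivative h x) (at x)" for h
      unfolding g'_def by (rule ext, rule vector_derivative_at[symmetric]) (use that in blast)
    have g': "\<forall>x. (g has_vector_derivative g' x) (at x)" "diff_times n g'" for n
      using g[of "Suc n"] eq by auto
    have fd: "(f has_derivative (\<lambda>v. (v * c) *\<^sub>R g' x)) (at x)" for x
      using has_derivative_scaleR_right[of g _ _ c] g'(1) 
      unfolding f has_vector_derivative_def by (force simp: mult.commute)
    have "frechet_derivative f (at x) v = (v * c) *\<^sub>R g' x" for x v
      using frechet_derivative_at[OF fd] by metis
    moreover have "f differentiable (at x)" for x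
      using fd differentiable_def by blast
    ultimately show ?case using g'(2) by auto
  qed
qed

lemma diff_times_Suc_imp: "diff_times (Suc n) f \<Longrightarrow> diff_times n f"
  by (induction n arbitrary: f) auto

lemma diff_times_const: "diff_times n (\<lambda>x. c)"
  by (induction n arbitrary: c) (auto intro!: exI[of _ "\<lambda>x. 0"])

lemma diff_times_add:
  "diff_times n f \<Longrightarrow> diff_times n g \<Longrightarrow> diff_times n (\<lambda>x. f x + g x)"
proof (induction n arbitrary: f g)
  case (Suc n)
  then obtain f' g' where "\<And>x. (f has_vector_derivative f' x) (at x)" "diff_times n f'"
    "\<And>x. (g has_vector_derivative g' x) (at x)" "diff_times n g'" by auto
  then show ?case
    by (auto intro!: exI[of _ "\<lambda>x. f' x + g' x"] has_vector_derivative_add Suc.IH)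
qed simp

lemma (in bounded_bilinear) diff_times:
  "diff_times n f \<Longrightarrow> diff_times n g \<Longrightarrow> diff_times n (\<lambda>x. prod (f x) (g x))"
proof (induction n arbitrary: f g)
  case (Suc n)
  then obtain f' g' where "\<And>x. (f has_vector_derivative f' x) (at x)" "diff_times n f'"
    "\<And>x. (g has_vector_derivative g' x) (at x)" "diff_times n g'" by auto
  then show ?case using Suc.prems[THEN diff_times_Suc_imp]
    by (auto intro!: exI[of _ "\<lambda>x. prod (f x) (g' x) + prod (f' x) (g x)"]
         has_vector_derivative diff_times_add Suc.IH)
qed simp

lemma smooth_const: "smooth (\<lambda>x::real. c)"
  by (simp add: smooth_iff_diff_times diff_times_const)

lemma smooth_add:
  fixes f :: "real \<Rightarrow> 'b::real_normed_vector"
  shows "smooth f \<Longrightarrow> smooth g \<Longrightarrow> smooth (\<lambda>x. f x + g x)"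
  by (simp add: smooth_iff_diff_times diff_times_add)

lemma (in bounded_bilinear) smooth:
  fixes f :: "real \<Rightarrow> 'a"
  shows "smooth f \<Longrightarrow> smooth g \<Longrightarrow> smooth (\<lambda>x. prod (f x) (g x))"
  by (simp add: smooth_iff_diff_times diff_times)

lemmas smooth_scaleR = bounded_bilinear.smooth[OF bounded_bilinear_scaleR]
  and smooth_mult = bounded_bilinear.smooth[OF bounded_bilinear_mult]
  and smooth_inner = bounded_bilinear.smooth[OF bounded_bilinear_inner]

lemma smooth_sin_cos: "smooth (\<lambda>x::real. sin (a * x))" "smooth (\<lambda>x::real. cos (a * x))"
proof -
  have "diff_times n (\<lambda>x. c * sin (a * x)) \<and> diff_times n (\<lambda>x. c * cos (a * x))" for n c
  proof (induction n arbitrary: c)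
    case (Suc n)
    have d: "((\<lambda>x. c * sin (a * x)) has_vector_derivative (c * a) * cos (a * x)) (at x)"
         "((\<lambda>x. c * cos (a * x)) has_vector_derivative (- c * a) * sin (a * x)) (at x)" for x
      by (auto intro!: derivative_eq_intros simp flip: has_real_derivative_iff_has_vector_derivative)
    show ?case unfolding diff_times.simps
      by (intro conjI exI[of _ "\<lambda>x. (c * a) * cos (a * x)"] exI[of _ "\<lambda>x. (- c * a) * sin (a * x)"]
          allI d Suc.IH[THEN conjunct1] Suc.IH[THEN conjunct2])
  qed simp
  from this[of _ 1] show "smooth (\<lambda>x::real. sin (a * x))" "smooth (\<lambda>x::real. cos (a * x))"
    by (auto simp: smooth_iff_diff_times)
qed

lemma periodic_derivative:
  assumes "periodic f" and f': "\<And>x. (f has_vector_derivative f' x) (at x)"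
  shows "periodic f'"
  unfolding periodic_def
proof
  fix x
  have "((\<lambda>x. x + 2 * pi) has_vector_derivative 1) (at x)"
    by (auto intro!: derivative_eq_intros simp flip: has_real_derivative_iff_has_vector_derivative)
  from vector_diff_chain_at[OF this f'] have "(f has_vector_derivative f' (x + 2 * pi)) (at x)"
    using assms(1) by (simp add: o_def periodic_def)
  then show "f' (x + 2 * pi) = f' x"
    using f' by (rule vector_derivative_unique_at)
qed

lemma smooth_sum:
  fixes f :: "'i \<Rightarrow> real \<Rightarrow> 'b::real_normed_vector"
  shows "(\<And>i. i \<in> J \<Longrightarrow> smooth (f i)) \<Longrightarrow> smooth (\<lambda>x. \<Sum>i\<in>J. f i x)"
  by (induction J rule: infinite_finite_induct) (auto intro: smooth_add smooth_const)

lemma smooth_derivatives: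
  fixes f :: "real \<Rightarrow> real"
  assumes "smooth f"
  obtains F where "F 0 = f" "\<And>n x. (F n has_real_derivative F (Suc n) x) (at x)"
proof
  define D where "D g = (\<lambda>x. vector_derivative g (at x))" for g :: "real \<Rightarrow> real"
  have "smooth ((D ^^ n) f)" for n
    by (induction n) (auto simp: assms D_def smooth_vector_derivative)
  from smooth_imp_vector_derivative[OF this]
  show "((D ^^ n) f has_real_derivative (D ^^ Suc n) f x) (at x)" for n x
    by (simp add: has_real_derivative_iff_has_vector_derivative D_def)
qed simp

section \<open>Hartley coefficients of periodic functions\<close>

text \<open>The kernel of the Hartley transform.  The functions \<open>cas (j x)\<close> for integers \<open>j\<close> span, together, the same
space as all \<open>cos (n x)\<close> and \<open>sin (n x)\<close>, but need no distinction between the two kinds.\<close>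

definition cas :: "real \<Rightarrow> real" where
  "cas x = cos x + sin x"

definition hartley :: "(real \<Rightarrow> real) \<Rightarrow> int \<Rightarrow> real" where
  "hartley f j = integral {0..2 * pi} (\<lambda>x. f x * cas (j * x))"

lemma continuous_on_cas [continuous_intros]:
  fixes f :: "real \<Rightarrow> real"
  shows "continuous_on S f \<Longrightarrow> continuous_on S (\<lambda>x. cas (f x))"
  unfolding cas_def by (intro continuous_on_add continuous_on_sin continuous_on_cos)

lemma cas_0 [simp]: "cas 0 = 1"
  by (simp add: cas_def)

interpretation cas: periodic_fun_simple cas "2 * pi"
  by unfold_locales (simp add: cas_def)

lemma has_real_derivative_cas: "((\<lambda>x. cas (a * x)) has_real_derivative a * cas (- a * x)) (at x)"
  unfolding cas_def by (auto intro!: derivative_eq_intros simp: algebra_simps)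

lemma cas_mult_cos: "cas a * cos b = (cas (a + b) + cas (a - b)) / 2"
  and cas_mult_sin: "cas a * sin b = (cas (b - a) - cas (- a - b)) / 2"
  and cas_mult_cas: "cas a * cas b = cos (a - b) + sin (a + b)"
  by (simp_all add: cas_def cos_add cos_diff sin_add sin_diff algebra_simps)

lemma continuous_on_mult_cas:
  "continuous_on UNIV f \<Longrightarrow> continuous_on S (\<lambda>x. f x * cas (j * x))"
  by (intro continuous_intros) (auto intro: continuous_on_subset)

lemma integrable_mult_cas:
  fixes f :: "real \<Rightarrow> real"
  shows "continuous_on UNIV f \<Longrightarrow> (\<lambda>x. f x * cas (j * x)) integrable_on {a..b}"
  by (intro integrable_continuous_real continuous_on_mult_cas)

lemma hartley_add:
  "continuous_on UNIV f \<Longrightarrow> continuous_on UNIV g \<Longrightarrow>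
     hartley (\<lambda>x. f x + g x) j = hartley f j + hartley g j"
  by (simp add: hartley_def distrib_right integral_add integrable_mult_cas)

lemma hartley_cmult: "hartley (\<lambda>x. c * f x) j = c * hartley f j"
  by (simp add: hartley_def mult.assoc)

lemma hartley_0 [simp]: "hartley (\<lambda>x. 0) j = 0"
  by (simp add: hartley_def)

lemma hartley_sum:
  "(\<And>i. i \<in> J \<Longrightarrow> continuous_on UNIV (f i)) \<Longrightarrow>
     hartley (\<lambda>x. \<Sum>i\<in>J. f i x) j = (\<Sum>i\<in>J. hartley (f i) j)"
  by (induction J rule: infinite_finite_induct) (simp_all add: hartley_add continuous_on_sum)

text \<open>Integration by parts; the boundary terms cancel by periodicity.\<close>

lemma hartley_derivative:
  assumes f': "\<And>x. (f has_real_derivative f' x) (at x)" and "periodic f"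
  shows "hartley f' j = - j * hartley f (- j)"
proof -
  have "continuous_on UNIV f"
    using f' by (meson DERIV_continuous continuous_at_imp_continuous_on)
  have "((\<lambda>x. f' x * cas (j * x) + j * (f x * cas (of_int (- j) * x))) has_integral
      f (2 * pi) * cas (j * (2 * pi)) - f 0 * cas (of_int j * 0)) {0..2 * pi}"
  proof (rule fundamental_theorem_of_calculus)
    fix x :: real
    have "((\<lambda>x. f x * cas (j * x)) has_real_derivative
        f' x * cas (j * x) + j * (f x * cas (of_int (- j) * x))) (at x)"
      using DERIV_mult[OF f' has_real_derivative_cas, of j x] by (simp add: algebra_simps)
    then show "((\<lambda>x. f x * cas (j * x)) has_vector_derivative
        f' x * cas (j * x) + j * (f x * cas (of_int (- j) * x))) (at x within {0..2 * pi})"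
      by (simp add: has_real_derivative_iff_has_vector_derivative has_vector_derivative_at_within)
  qed simp
  moreover have "f (2 * pi) = f 0" and "cas (j * (2 * pi)) = 1"
    using \<open>periodic f\<close> cas.plus_of_int[of 0 j] by (auto simp: periodic_def dest: spec[of _ 0])
  ultimately have "((\<lambda>x. f' x * cas (j * x) + j * (f x * cas (of_int (- j) * x))) has_integral 0) {0..2 * pi}"
    by simp
  from has_integral_diff[OF this has_integral_mult_right[OF integrable_integral,
      OF integrable_mult_cas[OF \<open>continuous_on UNIV f\<close>, of "- j"], of j]]
  have "((\<lambda>x. f' x * cas (j * x)) has_integral - j * hartley f (- j)) {0..2 * pi}"
    by (simp add: hartley_def)
  then show ?thesis
    by (simp add: hartley_def integral_unique)
qed

lemma hartley_iterated_derivatives: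
  assumes F: "\<And>n x. (F n has_real_derivative F (Suc n) x) (at x)" and "periodic (F 0)"
  shows "hartley (F 2) j = - (of_int j)\<^sup>2 * hartley (F 0) j"
    and "hartley (F 3) j = of_int j ^ 3 * hartley (F 0) (- j)"
    and "hartley (F 4) j = of_int j ^ 4 * hartley (F 0) j"
proof -
  have per: "periodic (F n)" for n
    by (induction n) (use assms in \<open>auto intro: periodic_derivative simp: has_real_derivative_iff_has_vector_derivative\<close>)
  have step: "hartley (F (Suc n)) j = - j * hartley (F n) (- j)" for n j
    by (rule hartley_derivative[OF F per])
  have 2: "hartley (F 2) j = - (of_int j)\<^sup>2 * hartley (F 0) j" for j
    by (simp add: eval_nat_numeral step)
  have 3: "hartley (F 3) j = of_int j ^ 3 * hartley (F 0) (- j)" for j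
    using step[of 2 j] unfolding 2 by (simp add: power2_eq_square power3_eq_cube)
  show "hartley (F 2) j = - (of_int j)\<^sup>2 * hartley (F 0) j" "hartley (F 3) j = of_int j ^ 3 * hartley (F 0) (- j)"
    "hartley (F 4) j = of_int j ^ 4 * hartley (F 0) j"
    using 2 3 step[of 3 j] unfolding 3 by (simp_all add: power3_eq_cube power4_eq_xxxx)
qed

lemma hartley_cas:
  fixes i j :: int
  shows "hartley (\<lambda>x. cas (i * x)) j = (if i = j then 2 * pi else 0)"
proof -
  have trig: "integral {0..2 * pi} (\<lambda>x. cos (n * x)) = (if n = 0 then 2 * pi else 0)"
    "integral {0..2 * pi} (\<lambda>x. sin (n * x)) = 0" for n :: int
  proof -
    have "((\<lambda>x. cos (n * x)) has_integral sin (n * (2 * pi)) / n - sin (of_int n * 0) / n) {0..2 * pi}" if "n \<noteq> 0"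
      by (rule fundamental_theorem_of_calculus)
       (use that in \<open>auto intro!: derivative_eq_intros simp flip: has_real_derivative_iff_has_vector_derivative\<close>)
    moreover have "sin (real_of_int n * (2 * pi)) = 0"
      using sin_int_2pin[of n] by (simp add: mult.commute)
    ultimately show "integral {0..2 * pi} (\<lambda>x. cos (n * x)) = (if n = 0 then 2 * pi else 0)"
      by (auto dest!: integral_unique)
    have "((\<lambda>x. sin (n * x)) has_integral (- cos (n * (2 * pi)) / n) - (- cos (of_int n * 0) / n)) {0..2 * pi}" if "n \<noteq> 0"
      by (rule fundamental_theorem_of_calculus)
       (use that in \<open>auto intro!: derivative_eq_intros simp flip: has_real_derivative_iff_has_vector_derivative\<close>)
    moreover have "cos (real_of_int n * (2 * pi)) = 1"
      using cos_int_2pin[of n] by (simp add: mult.commute)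
    ultimately show "integral {0..2 * pi} (\<lambda>x. sin (n * x)) = 0"
      by (cases "n = 0") (auto dest!: integral_unique)
  qed
  have "hartley (\<lambda>x. cas (i * x)) j =
      integral {0..2 * pi} (\<lambda>x. cos (of_int (i - j) * x) + sin (of_int (i + j) * x))"
    by (simp add: hartley_def cas_mult_cas algebra_simps)
  also have "\<dots> = integral {0..2 * pi} (\<lambda>x. cos (of_int (i - j) * x)) + integral {0..2 * pi} (\<lambda>x. sin (of_int (i + j) * x))"
    by (intro integral_add integrable_continuous_real continuous_intros)
  finally show ?thesis by (simp only: trig) auto
qed

text \<open>The functions without Hartley coefficients form an ideal: multiplication by \<open>cos\<close> or \<open>sin\<close> only moves
the index by one, and these two generate the polynomials on the circle.\<close>

lemma hartley_zero_mult_cos_sin: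
  assumes "continuous_on UNIV f" and "\<And>j. hartley f j = 0"
  shows "hartley (\<lambda>x. f x * cos x) j = 0" and "hartley (\<lambda>x. f x * sin x) j = 0"
proof -
  have "hartley (\<lambda>x. f x * cos x) j =
      integral {0..2 * pi} (\<lambda>x. (f x * cas (of_int (j + 1) * x) + f x * cas (of_int (j - 1) * x)) / 2)"
    unfolding hartley_def
  proof (rule arg_cong[of _ _ "integral _"], rule ext)
    fix x :: real
    have "f x * cos x * cas (j * x) = f x * (cas (j * x) * cos x)" by simp
    also have "\<dots> = f x * ((cas (j * x + x) + cas (j * x - x)) / 2)" by (simp only: cas_mult_cos)
    finally show "f x * cos x * cas (j * x) =
        (f x * cas (of_int (j + 1) * x) + f x * cas (of_int (j - 1) * x)) / 2"
      by (simp add: distrib_left left_diff_distrib distrib_right)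
  qed
  also have "\<dots> = (hartley f (j + 1) + hartley f (j - 1)) / 2"
    unfolding hartley_def integral_divide
    using integral_add[OF integrable_mult_cas integrable_mult_cas, OF assms(1) assms(1)] by simp
  finally show "hartley (\<lambda>x. f x * cos x) j = 0" using assms(2) by simp
  have "hartley (\<lambda>x. f x * sin x) j =
      integral {0..2 * pi} (\<lambda>x. (f x * cas (of_int (1 - j) * x) - f x * cas (of_int (- j - 1) * x)) / 2)"
    unfolding hartley_def
  proof (rule arg_cong[of _ _ "integral _"], rule ext)
    fix x :: real
    have "f x * sin x * cas (j * x) = f x * (cas (j * x) * sin x)" by simp
    also have "\<dots> = f x * ((cas (x - j * x) - cas (- (j * x) - x)) / 2)" by (simp only: cas_mult_sin)
    finally show "f x * sin x * cas (j * x) =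
        (f x * cas (of_int (1 - j) * x) - f x * cas (of_int (- j - 1) * x)) / 2"
      by (simp add: right_diff_distrib left_diff_distrib)
  qed
  also have "\<dots> = (hartley f (1 - j) - hartley f (- j - 1)) / 2"
    unfolding hartley_def integral_divide
    using integral_diff[OF integrable_mult_cas integrable_mult_cas, OF assms(1) assms(1)] by simp
  finally show "hartley (\<lambda>x. f x * sin x) j = 0" using assms(2) by simp
qed

lemma continuous_on_mult_polynomial_cis:
  fixes p :: "complex \<Rightarrow> real"
  assumes "real_polynomial_function p" and "continuous_on S f"
  shows "continuous_on S (\<lambda>x. f x * p (cis x))"
proof -
  have "continuous_on UNIV p"
    using assms(1) by (intro continuous_at_imp_continuous_on ballI continuous_real_polymonial_function)
  then have "continuous_on S (\<lambda>x. p (cis x))"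
    by (rule continuous_on_compose2) (auto intro: continuous_intros)
  then show ?thesis by (rule continuous_on_mult[OF assms(2)])
qed

text \<open>The induction generalises over \<open>f\<close>: in the case of a product, the second factor acts on the product of
\<open>f\<close> with the first.\<close>

lemma hartley_zero_mult_polynomial:
  fixes p :: "complex \<Rightarrow> real"
  assumes "real_polynomial_function p" and "continuous_on UNIV f" and "\<And>j. hartley f j = 0"
  shows "hartley (\<lambda>x. f x * p (cis x)) j = 0"
  using assms
proof (induction arbitrary: f j)
  case (linear p)
  note prems = linear.prems
  from linear interpret bounded_linear p by simp
  have "p (cis x) = p 1 * cos x + p \<i> * sin x" for x
  proof -
    have "cis x = cos x *\<^sub>R 1 + sin x *\<^sub>R \<i>" by (simp add: complex_eq_iff)
    then show ?thesis by (simp only: add scaleR) simp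
  qed
  then have "(\<lambda>x. f x * p (cis x)) = (\<lambda>x. p 1 * (f x * cos x) + p \<i> * (f x * sin x))"
    by (auto simp: fun_eq_iff algebra_simps)
  moreover have "continuous_on UNIV (\<lambda>x. p 1 * (f x * cos x))" "continuous_on UNIV (\<lambda>x. p \<i> * (f x * sin x))"
    using prems by (auto intro!: continuous_intros)
  ultimately show ?case
    using prems by (simp add: hartley_add hartley_cmult hartley_zero_mult_cos_sin)
next
  case (const c)
  then show ?case using hartley_cmult[of c f j] by (simp add: mult.commute)
next
  case (add p q)
  have "continuous_on UNIV (\<lambda>x. f x * p (cis x))" "continuous_on UNIV (\<lambda>x. f x * q (cis x))"
    using add by (auto intro!: continuous_on_mult_polynomial_cis)
  with add show ?case by (simp add: distrib_left hartley_add)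
next
  case (mult p q)
  have "continuous_on UNIV (\<lambda>x. f x * p (cis x))"
    using mult by (auto intro!: continuous_on_mult_polynomial_cis)
  with mult have "hartley (\<lambda>x. (f x * p (cis x)) * q (cis x)) j = 0" by blast
  then show ?case by (simp add: mult.assoc)
qed

lemma periodic_shift:
  assumes "periodic f" shows "f (x + of_int n * (2 * pi)) = f x"
proof -
  interpret periodic_fun_simple f "2 * pi"
    using assms by unfold_locales (simp add: periodic_def)
  show ?thesis by (rule plus_of_int)
qed

lemma obtain_period_representative:
  obtains n :: int and y :: real where "x = y + of_int n * (2 * pi)" "y \<in> {0..2 * pi}"
proof -
  define n where "n = \<lfloor>x / (2 * pi)\<rfloor>"
  have "of_int n \<le> x / (2 * pi)" "x / (2 * pi) \<le> of_int n + 1" by (auto simp: n_def)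
  then have "x - of_int n * (2 * pi) \<in> {0..2 * pi}" by (auto simp: field_simps)
  then show ?thesis using that[of "x - of_int n * (2 * pi)" n] by simp
qed

text \<open>\<open>Arg\<close> jumps at the negative axis, so continuity is obtained from compactness: preimages of closed sets
under the induced function are images of compact sets under \<open>cis\<close>.\<close>

lemma periodic_factors_through_circle:
  fixes f :: "real \<Rightarrow> real"
  assumes "continuous_on UNIV f" and "periodic f"
  obtains F where "continuous_on (sphere (0::complex) 1) F" "\<And>x. F (cis x) = f x"
proof
  define F where "F z = f (Arg z)" for z
  show F: "F (cis x) = f x" for x
  proof -
    have "cis (Arg (cis x)) = cis x" by (simp add: cis_Arg)
    then have "sin (Arg (cis x)) = sin x \<and> cos (Arg (cis x)) = cos x"
      by (metis cis.sel)
    then obtain n :: int where "Arg (cis x) = x + 2 * pi * of_int n"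
      unfolding sin_cos_eq_iff by blast
    then show ?thesis using periodic_shift[OF assms(2), of x n] by (simp add: F_def algebra_simps)
  qed
  show "continuous_on (sphere (0::complex) 1) F"
  proof (subst continuous_on_closed_vimage, simp, intro allI impI)
    fix C :: "real set" assume "closed C"
    have "F -` C \<inter> sphere 0 1 = cis ` ({0..2 * pi} \<inter> f -` C)"
    proof (intro equalityI subsetI)
      fix z assume z: "z \<in> F -` C \<inter> sphere 0 1"
      then have *: "z = cis (Arg z)" using rcis_cmod_Arg[of z] by (auto simp: rcis_def)
      obtain n y where "Arg z = y + of_int n * (2 * pi)" "y \<in> {0..2 * pi}"
        using obtain_period_representative by metis
      moreover from this have "cis (Arg z) = cis y"
        using sin_cos_eq_iff[of "Arg z" y] by (auto simp: complex_eq_iff algebra_simps)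
      ultimately show "z \<in> cis ` ({0..2 * pi} \<inter> f -` C)" using z F * by auto
    qed (auto simp: F)
    moreover have "compact ({0..2 * pi} \<inter> f -` C)"
      using continuous_on_closed_vimage[of UNIV f] assms(1) \<open>closed C\<close>
      by (auto intro: compact_Int_closed)
    then have "compact (cis ` ({0..2 * pi} \<inter> f -` C))"
      by (intro compact_continuous_image continuous_intros)
    ultimately show "closed (F -` C \<inter> sphere 0 1)" by (simp add: compact_imp_closed)
  qed
qed

text \<open>Completeness: \<open>f\<close> is orthogonal to all polynomials on the circle, which approximate \<open>f\<close> uniformly, so
\<open>f\<close> is orthogonal to itself.\<close>

lemma hartley_zero_imp_zero:
  assumes f: "continuous_on UNIV f" "periodic f" and zero: "\<And>j. hartley f j = 0"
  shows "f x = 0"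
proof -
  obtain F where F: "continuous_on (sphere (0::complex) 1) F" "\<And>x. F (cis x) = f x"
    using periodic_factors_through_circle[OF f] by blast
  have cont: "continuous_on S f" for S using f(1) continuous_on_subset by blast
  define M where "M = integral {0..2 * pi} (\<lambda>x. \<bar>f x\<bar>)"
  have int: "(\<lambda>x. f x * f x) integrable_on {0..2 * pi}" "(\<lambda>x. \<bar>f x\<bar>) integrable_on {0..2 * pi}"
    by (intro integrable_continuous_real continuous_intros cont)+
  have "M \<ge> 0" unfolding M_def by (rule integral_nonneg[OF int(2)]) simp
  have "integral {0..2 * pi} (\<lambda>x. f x * f x) \<le> e * M" if "e > 0" for e
  proof -
    obtain p where p: "real_polynomial_function p" "\<And>z. z \<in> sphere 0 1 \<Longrightarrow> \<bar>F z - p z\<bar> < e"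
      using Stone_Weierstrass_real_polynomial_function[OF compact_sphere F(1) \<open>e > 0\<close>] by metis
    have int_p: "(\<lambda>x. f x * p (cis x)) integrable_on {0..2 * pi}"
      using p(1) by (auto intro!: integrable_continuous_real continuous_on_mult_polynomial_cis cont)
    have "integral {0..2 * pi} (\<lambda>x. f x * p (cis x)) = 0"
      using hartley_zero_mult_polynomial[OF p(1) f(1) zero, of 0] by (simp add: hartley_def)
    then have "integral {0..2 * pi} (\<lambda>x. f x * f x) = integral {0..2 * pi} (\<lambda>x. f x * f x - f x * p (cis x))"
      by (subst integral_diff) (use int int_p in auto)
    also have "\<dots> \<le> integral {0..2 * pi} (\<lambda>x. e * \<bar>f x\<bar>)"
    proof (rule integral_le)
      fix x
      have "f x * f x - f x * p (cis x) \<le> \<bar>f x\<bar> * \<bar>F (cis x) - p (cis x)\<bar>"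
        by (simp add: F(2) flip: abs_mult right_diff_distrib)
      also have "\<dots> \<le> \<bar>f x\<bar> * e" using p(2)[of "cis x"] by (intro mult_left_mono) auto
      finally show "f x * f x - f x * p (cis x) \<le> e * \<bar>f x\<bar>" by (simp add: mult.commute)
    qed (use int int_p in \<open>auto intro: integrable_diff integrable_on_mult_right\<close>)
    finally show ?thesis by (simp add: M_def)
  qed
  \<comment> \<open>A positive integral \<open>I\<close> would give \<open>I \<le> I M / (M + 1) < I\<close>.\<close>
  from this[of "integral {0..2 * pi} (\<lambda>x. f x * f x) / (M + 1)"] \<open>M \<ge> 0\<close>
  have "integral {0..2 * pi} (\<lambda>x. f x * f x) \<le> 0"
    by (cases "integral {0..2 * pi} (\<lambda>x. f x * f x) \<le> 0") (simp_all add: field_simps)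
  moreover have "integral {0..2 * pi} (\<lambda>x. f x * f x) \<ge> 0"
    by (rule integral_nonneg[OF int(1)]) simp
  ultimately have "((\<lambda>x. f x * f x) has_integral 0) {0..2 * pi}"
    using integrable_integral[OF int(1)] by simp
  then have "f y * f y = 0" if "y \<in> {0..2 * pi}" for y
    using has_integral_0_cbox_imp_0[of 0 "2 * pi" "\<lambda>x. f x * f x" y] that
      continuous_on_mult[OF cont[of "{0..2 * pi}"] cont] pi_gt_zero by auto
  then show ?thesis
    using obtain_period_representative[of x] periodic_shift[OF f(2)] by (metis mult_eq_0_iff)
qed

lemma hartley_expansion:
  fixes x :: real
  assumes f: "continuous_on UNIV f" "periodic f" and "finite J" and zero: "\<And>j. j \<notin> J \<Longrightarrow> hartley f j = 0"
  shows "f x = (\<Sum>j\<in>J. hartley f j / (2 * pi) * cas (j * x))"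
proof -
  define s where "s x = (\<Sum>j\<in>J. hartley f j / (2 * pi) * cas (j * x))" for x :: real
  have "periodic (\<lambda>x. f x + (- 1) * s x)"
  proof -
    have "cas (j * (x + 2 * pi)) = cas (j * x)" for j :: int and x :: real
      using cas.plus_of_int[of "j * x" j] by (simp add: distrib_left)
    then show ?thesis using f(2) by (simp add: periodic_def s_def)
  qed
  moreover have cont: "continuous_on UNIV (\<lambda>x::real. hartley f i / (2 * pi) * cas (i * x))" for i
    by (intro continuous_intros)
  then have s: "continuous_on UNIV (\<lambda>x. (- 1) * s x)" unfolding s_def by (intro continuous_intros)
  then have "continuous_on UNIV (\<lambda>x. f x + (- 1) * s x)" by (rule continuous_on_add[OF f(1)])
  moreover have "hartley (\<lambda>x. f x + (- 1) * s x) j = 0" for j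
  proof -
    have "hartley s j = (\<Sum>i\<in>J. hartley f i / (2 * pi) * (if i = j then 2 * pi else 0))"
      unfolding s_def hartley_sum[OF cont] hartley_cmult hartley_cas ..
    also have "\<dots> = (\<Sum>i\<in>J. if i = j then hartley f i else 0)" by (rule sum.cong) auto
    also have "\<dots> = hartley f j" using zero \<open>finite J\<close> by (auto simp: sum.delta)
    finally show ?thesis unfolding hartley_add[OF f(1) s] hartley_cmult by simp
  qed
  ultimately have "f x + (- 1) * s x = 0" using hartley_zero_imp_zero[of "\<lambda>x. f x + (- 1) * s x" x] by blast
  then show ?thesis by (simp add: s_def)
qed

lemma smooth_cas: "smooth (\<lambda>x::real. cas (a * x))"
  unfolding cas_def by (intro smooth_add smooth_sin_cos)

lemma periodic_cas: "periodic (\<lambda>x. cas (of_int j * x))"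
  using cas.plus_of_int[of "of_int j * x" j for x] by (simp add: periodic_def distrib_left)

text \<open>Differentiation is a quarter turn of the argument, which gives all derivatives in closed form.\<close>

lemma has_real_derivative_cas_iterated:
  "((\<lambda>x. a ^ n * cas (a * x + n * (pi / 2))) has_real_derivative
     a ^ Suc n * cas (a * x + Suc n * (pi / 2))) (at x)"
proof -
  have "cas (a * x + Suc n * (pi / 2)) = cos (a * x + n * (pi / 2)) - sin (a * x + n * (pi / 2))"
    using sin_add[of "a * x + n * (pi / 2)" "pi / 2"] cos_add[of "a * x + n * (pi / 2)" "pi / 2"]
    by (simp add: cas_def algebra_simps add_divide_distrib)
  moreover have "((\<lambda>x. a ^ n * cas (a * x + n * (pi / 2))) has_real_derivative
     a ^ n * (a * (cos (a * x + n * (pi / 2)) - sin (a * x + n * (pi / 2))))) (at x)"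
    unfolding cas_def by (auto intro!: derivative_eq_intros simp: algebra_simps)
  ultimately show ?thesis by (simp add: mult.assoc mult.left_commute)
qed

lemma cas_quarter_turns:
  "cas (y + real 2 * (pi / 2)) = - cas y"
  "cas (y + real 3 * (pi / 2)) = - cas (- y)"
  "cas (y + real 4 * (pi / 2)) = cas y"
proof -
  have "y + real 3 * (pi / 2) = (y + pi) + pi / 2" by simp
  then show "cas (y + real 3 * (pi / 2)) = - cas (- y)"
    by (simp only: cas_def sin_add cos_add) simp
qed (simp_all add: cas_def)

section \<open>First variation of the bienergy\<close>

definition partial_t :: "(real \<times> real \<Rightarrow> 'b::real_normed_vector) \<Rightarrow> real \<times> real \<Rightarrow> 'b" where
  "partial_t F p = frechet_derivative F (at p) (1, 0)"

definition partial_\<gamma> :: "(real \<times> real \<Rightarrow> 'b::real_normed_vector) \<Rightarrow> real \<times> real \<Rightarrow> 'b" where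
  "partial_\<gamma> F p = frechet_derivative F (at p) (0, 1)"

lemma smooth_partial: 
  assumes "smooth F" shows "smooth (partial_t F)" "smooth (partial_\<gamma> F)"
  using assms by (auto elim: smooth.cases simp: partial_t_def[abs_def] partial_\<gamma>_def[abs_def])

lemma smooth_has_partial_derivatives:
  fixes F :: "real \<times> real \<Rightarrow> 'b::real_normed_vector"
  assumes "smooth F"
  shows "((\<lambda>t. F (t, \<gamma>)) has_vector_derivative partial_t F (t, \<gamma>)) (at t)"
    and "((\<lambda>\<gamma>. F (t, \<gamma>)) has_vector_derivative partial_\<gamma> F (t, \<gamma>)) (at \<gamma>)"
proof -
  have F: "(F has_derivative frechet_derivative F (at (t, \<gamma>))) (at (t, \<gamma>))"
    using assms by (auto elim: smooth.cases simp: frechet_derivative_works[symmetric])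
  then interpret bounded_linear "frechet_derivative F (at (t, \<gamma>))"
    by (rule has_derivative_bounded_linear)
  have "((\<lambda>t. F (t, \<gamma>)) has_derivative (\<lambda>h. frechet_derivative F (at (t, \<gamma>)) (h, 0))) (at t)"
    by (rule has_derivative_compose[of "\<lambda>t. (t, \<gamma>)", OF _ F]) (auto intro!: derivative_eq_intros)
  moreover have "frechet_derivative F (at (t, \<gamma>)) (h, 0) = h *\<^sub>R partial_t F (t, \<gamma>)" for h
    using scaleR[of h "(1, 0)"] by (simp add: partial_t_def)
  ultimately show "((\<lambda>t. F (t, \<gamma>)) has_vector_derivative partial_t F (t, \<gamma>)) (at t)"
    by (simp add: has_vector_derivative_def)
  have "((\<lambda>\<gamma>. F (t, \<gamma>)) has_derivative (\<lambda>h. frechet_derivative F (at (t, \<gamma>)) (0, h))) (at \<gamma>)"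
    by (rule has_derivative_compose[of "\<lambda>\<gamma>. (t, \<gamma>)", OF _ F]) (auto intro!: derivative_eq_intros)
  moreover have "frechet_derivative F (at (t, \<gamma>)) (0, h) = h *\<^sub>R partial_\<gamma> F (t, \<gamma>)" for h
    using scaleR[of h "(0, 1)"] by (simp add: partial_\<gamma>_def)
  ultimately show "((\<lambda>\<gamma>. F (t, \<gamma>)) has_vector_derivative partial_\<gamma> F (t, \<gamma>)) (at \<gamma>)"
    by (simp add: has_vector_derivative_def)
qed

lemma smooth_continuous_on:
  assumes "smooth F" shows "continuous_on S F"
  using assms by (auto elim!: smooth.cases intro!: continuous_at_imp_continuous_on differentiable_imp_continuous_within)

lemma smooth_continuous_on_pair [continuous_intros]:
  assumes "smooth F" and "continuous_on S f" "continuous_on S g"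
  shows "continuous_on S (\<lambda>x. F (f x, g x))"
  by (rule continuous_on_compose2[OF smooth_continuous_on[OF assms(1), of UNIV]])
    (use assms in \<open>auto intro: continuous_intros\<close>)

text \<open>Symmetry of second derivatives: differentiate
\<open>F (x, y) = F (x, a) + \<integral>\<^sub>a\<^sup>y \<partial>\<^sub>\<gamma> F (x, r) dr\<close> in \<open>x\<close> under the integral sign, then in \<open>y\<close>.\<close>

lemma mixed_partial_derivative:
  fixes F :: "real \<times> real \<Rightarrow> 'b::banach"
  assumes "smooth F"
  shows "((\<lambda>\<gamma>. partial_t F (t, \<gamma>)) has_vector_derivative partial_t (partial_\<gamma> F) (t, \<gamma>)) (at \<gamma>)"
proof -
  \<comment> \<open>Any base point to the left of \<open>\<gamma>\<close> would do.\<close>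
  define a where "a = \<gamma> - 1"
  note sm = smooth_partial[OF smooth_partial(2)[OF assms]] smooth_partial[OF assms]
  have eq: "partial_t F (t, y) = partial_t F (t, a) + integral {a..y} (\<lambda>r. partial_t (partial_\<gamma> F) (t, r))"
    if "a \<le> y" for y
  proof -
    have "((\<lambda>r. partial_\<gamma> F (x, r)) has_integral F (x, y) - F (x, a)) {a..y}" for x
      using that by (intro fundamental_theorem_of_calculus)
        (auto intro: has_vector_derivative_at_within smooth_has_partial_derivatives assms)
    then have "integral {a..y} (\<lambda>r. partial_\<gamma> F (x, r)) = F (x, y) - F (x, a)" for x
      by (rule integral_unique)
    then have F: "F (x, y) = F (x, a) + integral {a..y} (\<lambda>r. partial_\<gamma> F (x, r))" for x
      by simp
    have "((\<lambda>x. integral (cbox a y) (\<lambda>r. partial_\<gamma> F (x, r))) has_vector_derivative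
        integral (cbox a y) (\<lambda>r. partial_t (partial_\<gamma> F) (t, r))) (at t within UNIV)"
      by (rule leibniz_rule_vector_derivative)
       (auto intro!: smooth_has_partial_derivatives integrable_continuous_real continuous_intros sm
         sm[THEN smooth_continuous_on] simp: split_beta)
    then have "((\<lambda>x. F (x, y)) has_vector_derivative
        partial_t F (t, a) + integral {a..y} (\<lambda>r. partial_t (partial_\<gamma> F) (t, r))) (at t)"
      unfolding F[abs_def] by (intro has_vector_derivative_add smooth_has_partial_derivatives assms) simp
    then show ?thesis
      using smooth_has_partial_derivatives(1)[OF assms] vector_derivative_unique_at by metis
  qed
  have "((\<lambda>y. integral {a..y} (\<lambda>r. partial_t (partial_\<gamma> F) (t, r))) has_vector_derivative
      partial_t (partial_\<gamma> F) (t, \<gamma>)) (at \<gamma> within {a..\<gamma> + 1})"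
    by (rule integral_has_vector_derivative) (auto intro!: continuous_intros sm simp: a_def)
  moreover have "at \<gamma> within {a..\<gamma> + 1} = at \<gamma>"
    by (rule at_within_interior) (simp add: a_def)
  ultimately have "((\<lambda>y. partial_t F (t, a) + integral {a..y} (\<lambda>r. partial_t (partial_\<gamma> F) (t, r)))
      has_vector_derivative 0 + partial_t (partial_\<gamma> F) (t, \<gamma>)) (at \<gamma>)"
    by (intro has_vector_derivative_add) auto
  then have "((\<lambda>y. partial_t F (t, y)) has_vector_derivative 0 + partial_t (partial_\<gamma> F) (t, \<gamma>)) (at \<gamma>)"
    by (rule has_vector_derivative_transform_within_open[of _ _ _ "{a<..}"])
      (use eq[symmetric] in \<open>auto simp: a_def\<close>)
  then show ?thesis by simp
qed

lemma has_vector_derivative_inner: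
  assumes "(f has_vector_derivative f') (at x)" "(g has_vector_derivative g') (at x)"
  shows "((\<lambda>x. f x \<bullet> g x) has_vector_derivative f x \<bullet> g' + f' \<bullet> g x) (at x)"
  by (rule bounded_bilinear.has_vector_derivative[OF bounded_bilinear_inner assms])

text \<open>The tension field of a curve \<open>c\<close> on the unit sphere is \<open>c'' - (c'' \<bullet> c) c\<close>, and differentiating
\<open>c \<bullet> c = 1\<close> twice gives \<open>c'' \<bullet> c = - c' \<bullet> c'\<close>.\<close>

lemma norm_tension_sq:
  assumes c: "\<And>x. c x \<in> sphere 0 1"
    and c': "\<And>x. (c has_vector_derivative c' x) (at x)"
    and c'': "\<And>x. (c' has_vector_derivative c'' x) (at x)"
  shows "(norm (tension c x))\<^sup>2 = c'' x \<bullet> c'' x - (c' x \<bullet> c' x)\<^sup>2"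
proof -
  have cc: "c x \<bullet> c x = 1" for x using c[of x] by (simp add: dot_square_norm)
  have "((\<lambda>x. c x \<bullet> c x) has_vector_derivative c x \<bullet> c' x + c' x \<bullet> c x) (at x)" for x
    by (intro has_vector_derivative_inner c')
  then have cc': "c x \<bullet> c' x = 0" for x 
    using vector_derivative_unique_at[of "\<lambda>x. 1 :: real" 0 x]
    by (fastforce simp: cc inner_commute)
  have "((\<lambda>x. c x \<bullet> c' x) has_vector_derivative c x \<bullet> c'' x + c' x \<bullet> c' x) (at x)"
    by (intro has_vector_derivative_inner c' c'')
  then have cc'': "c'' x \<bullet> c x = - (c' x \<bullet> c' x)" 
    using vector_derivative_unique_at[of "\<lambda>x. 0 :: real" 0 x]
    by (fastforce simp: cc' inner_commute)
  have "diff_e c = c'" "vector_derivative c' (at x) = c'' x"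
    using c' c'' by (auto simp: diff_e_def fun_eq_iff vector_derivative_at)
  then have "tension c x = c'' x - (c'' x \<bullet> c x) *\<^sub>R c x"
    by (simp add: tension_def nabla_def)
  then show ?thesis
    unfolding power2_norm_eq_inner
    by (simp add: inner_diff inner_add inner_commute[of "c x" "c'' x"] cc cc'' power2_eq_square)
qed

lemma bienergy_has_derivative:
  fixes \<Phi> :: "real \<times> real \<Rightarrow> 'a::euclidean_space"
  assumes "variation \<phi> \<Phi>"
  defines "A \<equiv> partial_\<gamma> \<Phi>"
  defines "B \<equiv> partial_\<gamma> A"
  shows "((\<lambda>t. bienergy (\<lambda>\<gamma>. \<Phi> (t, \<gamma>))) has_real_derivative
     integral {0..2 * pi} (\<lambda>\<gamma>. B (t, \<gamma>) \<bullet> partial_t B (t, \<gamma>)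
        - 2 * (A (t, \<gamma>) \<bullet> A (t, \<gamma>)) * (A (t, \<gamma>) \<bullet> partial_t A (t, \<gamma>)))) (at t)"
proof -
  have \<Phi>: "smooth \<Phi>" "\<And>t \<gamma>. \<Phi> (t, \<gamma>) \<in> sphere 0 1"
    using assms(1) by (auto simp: variation_def circle_sphere_map_def)
  have sm: "smooth A" "smooth B" "smooth (partial_t A)" "smooth (partial_t B)"
    unfolding B_def A_def using \<Phi>(1) by (auto intro: smooth_partial)
  define E where "E t \<gamma> = 1 / 2 * (B (t, \<gamma>) \<bullet> B (t, \<gamma>) - (A (t, \<gamma>) \<bullet> A (t, \<gamma>))\<^sup>2)" for t \<gamma>
  have "(norm (tension (\<lambda>\<gamma>. \<Phi> (t, \<gamma>)) \<gamma>))\<^sup>2 = B (t, \<gamma>) \<bullet> B (t, \<gamma>) - (A (t, \<gamma>) \<bullet> A (t, \<gamma>))\<^sup>2" for t \<gamma>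
    by (rule norm_tension_sq)
      (use \<Phi> sm in \<open>auto simp: A_def B_def intro: smooth_has_partial_derivatives\<close>)
  then have E: "bienergy (\<lambda>\<gamma>. \<Phi> (t, \<gamma>)) = integral (cbox 0 (2 * pi)) (E t)" for t
    by (simp add: bienergy_def E_def[abs_def])
  show ?thesis
    unfolding E unfolding cbox_interval[symmetric]
  proof (rule leibniz_rule_field_derivative[of UNIV, simplified])
    fix x y
    have in_t: "((\<lambda>x. G (x, y) \<bullet> G (x, y)) has_real_derivative 2 * (G (x, y) \<bullet> partial_t G (x, y))) (at x)"
      if "smooth G" for G :: "real \<times> real \<Rightarrow> 'a"
      using has_vector_derivative_inner[OF smooth_has_partial_derivatives(1)[OF that, of y x]
         smooth_has_partial_derivatives(1)[OF that, of y x]]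
      by (simp add: has_real_derivative_iff_has_vector_derivative inner_commute)
    show "((\<lambda>x. E x y) has_real_derivative B (x, y) \<bullet> partial_t B (x, y)
        - 2 * (A (x, y) \<bullet> A (x, y)) * (A (x, y) \<bullet> partial_t A (x, y))) (at x)"
      unfolding E_def by (auto intro!: derivative_eq_intros in_t sm)
  qed (auto simp: E_def[abs_def] split_beta intro!: integrable_continuous_real continuous_intros
      sm sm[THEN smooth_continuous_on])
qed

text \<open>With \<open>Q\<close> the derivative in \<open>t\<close> of the velocity, the integrand of the first variation is
\<open>c'' \<bullet> Q' - 2 s c' \<bullet> Q = c'' \<bullet> Q' + c''' \<bullet> Q\<close>, the derivative of the periodic function \<open>c'' \<bullet> Q\<close>.\<close>

lemma constant_speed_biharmonic:
  fixes c :: "real \<Rightarrow> 'a::euclidean_space"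
  assumes c: "circle_sphere_map c"
    and c': "\<And>x. (c has_vector_derivative c' x) (at x)"
    and c'': "\<And>x. (c' has_vector_derivative c'' x) (at x)"
    and c''': "\<And>x. (c'' has_vector_derivative - (2 * s) *\<^sub>R c' x) (at x)"
    and speed: "\<And>x. c' x \<bullet> c' x = s"
  shows "biharmonic c"
  unfolding biharmonic_def
proof (intro conjI allI impI c)
  fix \<Phi> assume var: "variation c \<Phi>"
  then have \<Phi>: "smooth \<Phi>" "\<And>\<gamma>. \<Phi> (0, \<gamma>) = c \<gamma>" "\<And>t. periodic (\<lambda>\<gamma>. \<Phi> (t, \<gamma>))"
    by (auto simp: variation_def circle_sphere_map_def)
  define A where "A = partial_\<gamma> \<Phi>"
  define B where "B = partial_\<gamma> A"
  have sm: "smooth A" "smooth B"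
    unfolding B_def A_def using \<Phi>(1) by (auto intro: smooth_partial)
  have A: "A (0, x) = c' x" for x
    using smooth_has_partial_derivatives(2)[OF \<Phi>(1), of 0] c' unfolding \<Phi>(2) A_def
    by (metis vector_derivative_unique_at)
  have B: "B (0, x) = c'' x" for x
    using smooth_has_partial_derivatives(2)[OF sm(1), of 0] c'' unfolding A B_def
    by (metis vector_derivative_unique_at)
  have "periodic (\<lambda>\<gamma>. A (t, \<gamma>))" for t
    unfolding A_def
    by (rule periodic_derivative[OF \<Phi>(3) smooth_has_partial_derivatives(2)[OF \<Phi>(1)]])
  then have "A (t, 2 * pi) = A (t, 0)" for t
    unfolding periodic_def by (metis add_0)
  then have Q: "partial_t A (0, 2 * pi) = partial_t A (0, 0)"
    using smooth_has_partial_derivatives(1)[OF sm(1), of "2 * pi" 0]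
       smooth_has_partial_derivatives(1)[OF sm(1), of 0 0]
    by (intro vector_derivative_unique_at) simp_all
  have "periodic c"
    using c by (simp add: circle_sphere_map_def)
  from periodic_derivative[OF periodic_derivative[OF this c'] c'']
  have c''_per: "c'' (2 * pi) = c'' 0"
    unfolding periodic_def by (metis add_0)
  have "((\<lambda>\<gamma>. c'' \<gamma> \<bullet> partial_t B (0, \<gamma>) + (- (2 * s) *\<^sub>R c' \<gamma>) \<bullet> partial_t A (0, \<gamma>)) has_integral
      c'' (2 * pi) \<bullet> partial_t A (0, 2 * pi) - c'' 0 \<bullet> partial_t A (0, 0)) {0..2 * pi}"
  proof (rule fundamental_theorem_of_calculus)
    fix \<gamma>
    have "((\<lambda>\<gamma>. c'' \<gamma> \<bullet> partial_t A (0, \<gamma>)) has_vector_derivative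
        c'' \<gamma> \<bullet> partial_t B (0, \<gamma>) + (- (2 * s) *\<^sub>R c' \<gamma>) \<bullet> partial_t A (0, \<gamma>)) (at \<gamma>)"
      unfolding B_def
      by (rule has_vector_derivative_inner[OF c''' mixed_partial_derivative[OF sm(1)]])
    then show "((\<lambda>\<gamma>. c'' \<gamma> \<bullet> partial_t A (0, \<gamma>)) has_vector_derivative
        c'' \<gamma> \<bullet> partial_t B (0, \<gamma>) + (- (2 * s) *\<^sub>R c' \<gamma>) \<bullet> partial_t A (0, \<gamma>))
        (at \<gamma> within {0..2 * pi})"
      by (rule has_vector_derivative_at_within)
  qed simp
  also have "c'' (2 * pi) \<bullet> partial_t A (0, 2 * pi) - c'' 0 \<bullet> partial_t A (0, 0) = 0"
    using c''_per Q by simp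
  finally have "integral {0..2 * pi} (\<lambda>\<gamma>. B (0, \<gamma>) \<bullet> partial_t B (0, \<gamma>)
        - 2 * (A (0, \<gamma>) \<bullet> A (0, \<gamma>)) * (A (0, \<gamma>) \<bullet> partial_t A (0, \<gamma>))) = 0"
    by (simp add: A B speed integral_unique)
  then show "((\<lambda>t. bienergy (\<lambda>\<gamma>. \<Phi> (t, \<gamma>))) has_real_derivative 0) (at 0)"
    using bienergy_has_derivative[OF var, of 0] by (simp add: A_def B_def)
qed

section \<open>The frame along the map and the second variation operator\<close>

text \<open>The speed of \<open>phi k\<close>, which is also the rate at which the frame turns relative to the
Levi-Civita connection.\<close>

definition freq :: "nat \<Rightarrow> real" where
  "freq k = k / sqrt 2"

definition tangent :: "nat \<Rightarrow> real \<Rightarrow> real ^ 3" where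
  "tangent k x = vector [- sin (k * x), cos (k * x), 0]"

definition normal :: "nat \<Rightarrow> real \<Rightarrow> real ^ 3" where
  "normal k x = vector [1 / sqrt 2 * cos (k * x), 1 / sqrt 2 * sin (k * x), - 1 / sqrt 2]"

lemma vector_3_eq_axes: "(vector [a, b, c] :: real ^ 3) = a *\<^sub>R axis 1 1 + b *\<^sub>R axis 2 1 + c *\<^sub>R axis 3 1"
  by (simp add: vec_eq_iff forall_3 axis_def)

lemma frame_orthonormal [simp]:
  "tangent k x \<bullet> tangent k x = 1" "normal k x \<bullet> normal k x = 1" "phi k x \<bullet> phi k x = 1"
  "tangent k x \<bullet> normal k x = 0" "normal k x \<bullet> tangent k x = 0"
  "tangent k x \<bullet> phi k x = 0" "phi k x \<bullet> tangent k x = 0"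
  "normal k x \<bullet> phi k x = 0" "phi k x \<bullet> normal k x = 0"
proof -
  have "cos (k * x) * cos (k * x) = 1 - sin (k * x) * sin (k * x)"
    using sin_cos_squared_add3[of "k * x"] by linarith
  then show "tangent k x \<bullet> tangent k x = 1" "normal k x \<bullet> normal k x = 1" "phi k x \<bullet> phi k x = 1"
    "tangent k x \<bullet> normal k x = 0" "normal k x \<bullet> tangent k x = 0"
    "tangent k x \<bullet> phi k x = 0" "phi k x \<bullet> tangent k x = 0"
    "normal k x \<bullet> phi k x = 0" "phi k x \<bullet> normal k x = 0"
    by (simp_all add: tangent_def normal_def phi_def inner_vec_def sum_3 field_simps)
qed

lemma frame_expansion:
  assumes "v \<bullet> phi k x = 0"
  shows "v = (v \<bullet> tangent k x) *\<^sub>R tangent k x + (v \<bullet> normal k x) *\<^sub>R normal k x"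
proof -
  define s c where sc: "s = sin (k * x)" "c = cos (k * x)"
  have cc: "c * c = 1 - s * s"
    using sin_cos_squared_add3[of "k * x"] unfolding sc by linarith
  have v3: "v $ 3 = - (v $ 1 * c + v $ 2 * s)"
    using assms by (simp add: phi_def inner_vec_def sum_3 sc field_simps)
  have frame: "tangent k x = vector [- s, c, 0]" "normal k x = vector [1 / sqrt 2 * c, 1 / sqrt 2 * s, - 1 / sqrt 2]"
    by (simp_all add: tangent_def normal_def sc)
  have 1: "v \<bullet> tangent k x = v $ 2 * c - v $ 1 * s"
    by (simp add: frame inner_vec_def sum_3)
  have 2: "v \<bullet> normal k x = sqrt 2 * (v $ 1 * c + v $ 2 * s)"
    by (simp add: frame inner_vec_def sum_3 v3 field_simps)
  have "v $ 1 = (c * c + s * s) * v $ 1" "v $ 2 = (c * c + s * s) * v $ 2" by (simp_all add: cc)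
  then show ?thesis
    unfolding 1 2
    by (simp add: vec_eq_iff forall_3 v3 frame algebra_simps)
qed

lemma frame_derivatives:
  "(phi k has_vector_derivative freq k *\<^sub>R tangent k x) (at x)"
  "(tangent k has_vector_derivative - freq k *\<^sub>R (phi k x + normal k x)) (at x)"
  "(normal k has_vector_derivative freq k *\<^sub>R tangent k x) (at x)"
proof -
  have trig: "((\<lambda>x. cos (k * x)) has_real_derivative - k * sin (k * x)) (at x)"
    "((\<lambda>x. sin (k * x)) has_real_derivative k * cos (k * x)) (at x)"
    by (auto intro!: derivative_eq_intros)
  have vec: "((\<lambda>x. vector [f x, g x, h x] :: real ^ 3) has_vector_derivative vector [f', g', h']) (at x)"
    if "(f has_real_derivative f') (at x)" "(g has_real_derivative g') (at x)"
      "(h has_real_derivative h') (at x)" for f g h f' g' h'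
  proof -
    have "((\<lambda>x. vector [f x, g x, h x] :: real ^ 3) has_vector_derivative
        (f x *\<^sub>R 0 + f' *\<^sub>R axis 1 1) + (g x *\<^sub>R 0 + g' *\<^sub>R axis 2 1) + (h x *\<^sub>R 0 + h' *\<^sub>R axis 3 1)) (at x)"
      unfolding vector_3_eq_axes
      by (intro has_vector_derivative_add has_vector_derivative_scaleR has_vector_derivative_const that)
    then show ?thesis by (simp add: vector_3_eq_axes)
  qed
  show "(phi k has_vector_derivative freq k *\<^sub>R tangent k x) (at x)"
    using vec[OF DERIV_cmult[OF trig(1)] DERIV_cmult[OF trig(2)] DERIV_const, of "1 / sqrt 2" "1 / sqrt 2" "1 / sqrt 2"]
    unfolding phi_def[abs_def] by (rule has_vector_derivative_eq_rhs)
      (simp add: freq_def tangent_def vec_eq_iff forall_3)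
  show "(normal k has_vector_derivative freq k *\<^sub>R tangent k x) (at x)"
    using vec[OF DERIV_cmult[OF trig(1)] DERIV_cmult[OF trig(2)] DERIV_const, of "1 / sqrt 2" "1 / sqrt 2" "- 1 / sqrt 2"]
    unfolding normal_def[abs_def] by (rule has_vector_derivative_eq_rhs)
      (simp add: freq_def tangent_def vec_eq_iff forall_3)
  show "(tangent k has_vector_derivative - freq k *\<^sub>R (phi k x + normal k x)) (at x)"
    using vec[OF DERIV_minus[OF trig(2)] trig(1) DERIV_const, of 0]
    unfolding tangent_def[abs_def] by (rule has_vector_derivative_eq_rhs)
      (simp add: freq_def phi_def normal_def vec_eq_iff forall_3 field_simps)
qed

lemma smooth_frame: "smooth (phi k)" "smooth (tangent k)" "smooth (normal k)"
proof -
  have t: "tangent k = (\<lambda>x::real. vector [(- 1) * sin (k * x), cos (k * x), 0])"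
    by (simp add: tangent_def fun_eq_iff)
  show "smooth (phi k)" "smooth (tangent k)" "smooth (normal k)"
    unfolding phi_def[abs_def] normal_def[abs_def] t vector_3_eq_axes
    by (intro smooth_add smooth_scaleR smooth_mult smooth_const smooth_sin_cos)+
qed

lemma periodic_frame: "periodic (phi k)" "periodic (tangent k)" "periodic (normal k)"
proof -
  have "sin (k * (x + 2 * pi)) = sin (k * x) \<and> cos (k * (x + 2 * pi)) = cos (k * x)" for x :: real
    unfolding sin_cos_eq_iff by (rule exI[of _ "int k"]) (simp add: algebra_simps)
  then show "periodic (phi k)" "periodic (tangent k)" "periodic (normal k)"
    by (simp_all add: periodic_def phi_def tangent_def normal_def)
qed

lemma circle_sphere_map_phi: "circle_sphere_map (phi k)"
  unfolding circle_sphere_map_def using smooth_frame periodic_frame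
  by (auto simp: norm_eq_1)

lemma biharmonic_phi: "biharmonic (phi k)"
proof (rule constant_speed_biharmonic[OF circle_sphere_map_phi frame_derivatives(1)])
  let ?m = "freq k"
  show "((\<lambda>x. ?m *\<^sub>R tangent k x) has_vector_derivative ?m *\<^sub>R - ?m *\<^sub>R (phi k x + normal k x)) (at x)" for x
    by (rule bounded_linear.has_vector_derivative[OF bounded_linear_scaleR_right frame_derivatives(2)])
  have "((\<lambda>x. ?m *\<^sub>R - ?m *\<^sub>R (phi k x + normal k x)) has_vector_derivative
      ?m *\<^sub>R - ?m *\<^sub>R (?m *\<^sub>R tangent k x + ?m *\<^sub>R tangent k x)) (at x)" for x
    by (intro bounded_linear.has_vector_derivative[OF bounded_linear_scaleR_right]
        has_vector_derivative_add frame_derivatives)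
  moreover have "?m *\<^sub>R - ?m *\<^sub>R (?m *\<^sub>R tangent k x + ?m *\<^sub>R tangent k x)
     = - (2 * ?m\<^sup>2) *\<^sub>R ?m *\<^sub>R tangent k x" for x
    by (simp add: power2_eq_square algebra_simps flip: scaleR_2)
  ultimately show "((\<lambda>x. ?m *\<^sub>R - ?m *\<^sub>R (phi k x + normal k x)) has_vector_derivative
      - (2 * ?m\<^sup>2) *\<^sub>R ?m *\<^sub>R tangent k x) (at x)" for x by metis
qed (simp add: power2_eq_square)

definition frame_vec :: "nat \<Rightarrow> real \<Rightarrow> real \<Rightarrow> real \<Rightarrow> real ^ 3" where
  "frame_vec k x a b = a *\<^sub>R tangent k x + b *\<^sub>R normal k x"

definition frame_sec :: "nat \<Rightarrow> (real \<Rightarrow> real) \<Rightarrow> (real \<Rightarrow> real) \<Rightarrow> real \<Rightarrow> real ^ 3" where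
  "frame_sec k f g x = frame_vec k x (f x) (g x)"

lemma smooth_frame_sec: "smooth f \<Longrightarrow> smooth g \<Longrightarrow> smooth (frame_sec k f g)"
  unfolding frame_sec_def[abs_def] frame_vec_def by (intro smooth_add smooth_scaleR smooth_frame)

lemma frame_vec_simps:
  "frame_vec k x a b + frame_vec k x a' b' = frame_vec k x (a + a') (b + b')"
  "frame_vec k x a b - frame_vec k x a' b' = frame_vec k x (a - a') (b - b')"
  "- frame_vec k x a b = frame_vec k x (- a) (- b)"
  "c *\<^sub>R frame_vec k x a b = frame_vec k x (c * a) (c * b)"
  "frame_vec k x a b \<bullet> frame_vec k x a' b' = a * a' + b * b'"
  "(norm (frame_vec k x a b))\<^sup>2 = a * a + b * b"
  by (simp_all add: frame_vec_def power2_norm_eq_inner algebra_simps)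

lemma frame_vec_coordinates:
  "frame_vec k x a b \<bullet> tangent k x = a" "frame_vec k x a b \<bullet> normal k x = b"
  "frame_vec k x a b \<bullet> phi k x = 0"
  by (simp_all add: frame_vec_def inner_add)

lemma frame_vec_eq_iff: "frame_vec k x a b = frame_vec k x a' b' \<longleftrightarrow> a = a' \<and> b = b'"
  by (metis frame_vec_coordinates)

text \<open>The frame turns at the constant rate \<open>freq k\<close>, hence the connection has constant coefficients.\<close>

lemma nabla_frame_sec:
  assumes f: "\<And>x. (f has_real_derivative f' x) (at x)" and g: "\<And>x. (g has_real_derivative g' x) (at x)"
  shows "nabla (phi k) (frame_sec k f g) =
    frame_sec k (\<lambda>x. f' x + freq k * g x) (\<lambda>x. g' x - freq k * f x)"
proof
  fix x
  have "(frame_sec k f g has_vector_derivative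
      (f x *\<^sub>R (- freq k *\<^sub>R (phi k x + normal k x)) + f' x *\<^sub>R tangent k x) +
      (g x *\<^sub>R (freq k *\<^sub>R tangent k x) + g' x *\<^sub>R normal k x)) (at x)"
    unfolding frame_sec_def[abs_def] frame_vec_def
    by (intro has_vector_derivative_add has_vector_derivative_scaleR f g frame_derivatives)
  then show "nabla (phi k) (frame_sec k f g) x =
      frame_sec k (\<lambda>x. f' x + freq k * g x) (\<lambda>x. g' x - freq k * f x) x"
    unfolding nabla_def by (subst (1 2) vector_derivative_at, assumption, assumption)
      (simp add: frame_sec_def frame_vec_def algebra_simps)
qed

lemma diff_e_phi: "diff_e (phi k) = frame_sec k (\<lambda>x. freq k) (\<lambda>x. 0)"
  using frame_derivatives(1)[THEN vector_derivative_at]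
  by (simp add: diff_e_def fun_eq_iff frame_sec_def frame_vec_def)

lemma tension_phi: "tension (phi k) = frame_sec k (\<lambda>x. 0) (\<lambda>x. - (freq k)\<^sup>2)"
  unfolding tension_def diff_e_phi
  by (subst nabla_frame_sec[of _ "\<lambda>x. 0" _ "\<lambda>x. 0"]) (simp_all add: power2_eq_square)

lemma nabla_tension_phi: "nabla (phi k) (tension (phi k)) = frame_sec k (\<lambda>x. - ((freq k) ^ 3)) (\<lambda>x. 0)"
  unfolding tension_phi
  by (subst nabla_frame_sec[of _ "\<lambda>x. 0" _ "\<lambda>x. 0"]) (simp_all add: power2_eq_square power3_eq_cube mult.assoc)

lemma rough_laplacian_frame_sec:
  assumes f: "\<And>x. (f has_real_derivative f' x) (at x)" "\<And>x. (f' has_real_derivative f'' x) (at x)"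
    and g: "\<And>x. (g has_real_derivative g' x) (at x)" "\<And>x. (g' has_real_derivative g'' x) (at x)"
  shows "rough_laplacian (phi k) (frame_sec k f g) =
    frame_sec k (\<lambda>x. - f'' x - 2 * freq k * g' x + (freq k)\<^sup>2 * f x)
      (\<lambda>x. - g'' x + 2 * freq k * f' x + (freq k)\<^sup>2 * g x)"
proof
  fix x
  have "nabla (phi k) (nabla (phi k) (frame_sec k f g)) =
      frame_sec k (\<lambda>x. (f'' x + freq k * g' x) + freq k * (g' x - freq k * f x))
        (\<lambda>x. (g'' x - freq k * f' x) - freq k * (f' x + freq k * g x))"
    unfolding nabla_frame_sec[OF f(1) g(1)]
    by (rule nabla_frame_sec) (auto intro!: derivative_eq_intros f g)
  then show "rough_laplacian (phi k) (frame_sec k f g) x =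
    frame_sec k (\<lambda>x. - f'' x - 2 * freq k * g' x + (freq k)\<^sup>2 * f x)
      (\<lambda>x. - g'' x + 2 * freq k * f' x + (freq k)\<^sup>2 * g x) x"
    by (simp add: rough_laplacian_def frame_sec_def frame_vec_simps frame_vec_eq_iff
        power2_eq_square algebra_simps)
qed

text \<open>The second variation operator in the frame.  The functions \<open>F n\<close> and \<open>G n\<close> are the \<open>n\<close>-th derivatives of the
two coordinates.  Most lower order terms cancel: only even derivatives of the same coordinate and
third derivatives of the other one remain.\<close>

lemma I2_frame_sec:
  assumes F: "\<And>n x. (F n has_real_derivative F (Suc n) x) (at x)"
    and G: "\<And>n x. (G n has_real_derivative G (Suc n) x) (at x)"
  shows "I2 (phi k) (frame_sec k (F 0) (G 0)) =
    frame_sec k (\<lambda>x. F 4 x - 6 * (freq k)\<^sup>2 * F 2 x + 4 * freq k * G 3 x)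
      (\<lambda>x. G 4 x - 4 * freq k * F 3 x - 4 * (freq k)\<^sup>2 * G 2 x - 4 * (freq k) ^ 4 * G 0 x)"
proof
  fix x
  define m where "m = freq k"
  have d: "(F 0 has_real_derivative F 1 x) (at x)" "(F 1 has_real_derivative F 2 x) (at x)"
    "(F 2 has_real_derivative F 3 x) (at x)" "(F 3 has_real_derivative F 4 x) (at x)"
    "(G 0 has_real_derivative G 1 x) (at x)" "(G 1 has_real_derivative G 2 x) (at x)"
    "(G 2 has_real_derivative G 3 x) (at x)" "(G 3 has_real_derivative G 4 x) (at x)" for x
    using F[of 0] F[of 1] F[of 2] F[of 3] G[of 0] G[of 1] G[of 2] G[of 3]
    by (simp_all add: eval_nat_numeral)
  let ?V = "frame_sec k (F 0) (G 0)"
  have nab: "nabla (phi k) ?V = frame_sec k (\<lambda>x. F 1 x + m * G 0 x) (\<lambda>x. G 1 x - m * F 0 x)"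
    unfolding m_def by (rule nabla_frame_sec) (rule d)+
  have lap: "rough_laplacian (phi k) ?V = frame_sec k (\<lambda>x. - F 2 x - 2 * m * G 1 x + m\<^sup>2 * F 0 x)
      (\<lambda>x. - G 2 x + 2 * m * F 1 x + m\<^sup>2 * G 0 x)"
    unfolding m_def by (rule rough_laplacian_frame_sec) (rule d)+
  have laplap: "rough_laplacian (phi k) (rough_laplacian (phi k) ?V) = frame_sec k
      (\<lambda>x. - (- F 4 x - 2 * m * G 3 x + m\<^sup>2 * F 2 x) - 2 * m * (- G 3 x + 2 * m * F 2 x + m\<^sup>2 * G 1 x)
           + m\<^sup>2 * (- F 2 x - 2 * m * G 1 x + m\<^sup>2 * F 0 x))
      (\<lambda>x. - (- G 4 x + 2 * m * F 3 x + m\<^sup>2 * G 2 x) + 2 * m * (- F 3 x - 2 * m * G 2 x + m\<^sup>2 * F 1 x)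
           + m\<^sup>2 * (- G 2 x + 2 * m * F 1 x + m\<^sup>2 * G 0 x))"
    unfolding lap unfolding m_def by (rule rough_laplacian_frame_sec) (auto intro!: derivative_eq_intros d simp del: One_nat_def)
  have T: "(\<lambda>x. T_op (phi k) ?V x - diff_sq (phi k) x *\<^sub>R ?V x) = frame_sec k (\<lambda>x. 0) (\<lambda>x. - m\<^sup>2 * G 0 x)"
    unfolding fun_eq_iff T_op_def diff_sq_def diff_e_phi frame_sec_def frame_vec_simps
      frame_vec_eq_iff m_def
    by (simp add: power2_eq_square)
  have lapT: "rough_laplacian (phi k) (\<lambda>x. T_op (phi k) ?V x - diff_sq (phi k) x *\<^sub>R ?V x) = frame_sec k
      (\<lambda>x. - 0 - 2 * m * (- m\<^sup>2 * G 1 x) + m\<^sup>2 * 0)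
      (\<lambda>x. - (- m\<^sup>2 * G 2 x) + 2 * m * 0 + m\<^sup>2 * (- m\<^sup>2 * G 0 x))"
    unfolding T unfolding m_def by (rule rough_laplacian_frame_sec) (auto intro!: derivative_eq_intros d simp del: One_nat_def)
  have "I2 (phi k) ?V x =
    frame_vec k x (F 4 x - 6 * m\<^sup>2 * F 2 x + 4 * m * G 3 x)
      (G 4 x - 4 * m * F 3 x - 4 * m\<^sup>2 * G 2 x - 4 * m ^ 4 * G 0 x)"
    unfolding I2_def laplap lapT nabla_tension_phi diff_inner_def nab
    unfolding T_op_def lap diff_sq_def diff_e_phi tension_phi frame_sec_def frame_vec_simps m_def[symmetric]
    unfolding frame_vec_eq_iff
    by (intro conjI; simp add: algebra_simps power2_eq_square power3_eq_cube power4_eq_xxxx)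
  then show "I2 (phi k) (frame_sec k (F 0) (G 0)) x =
    frame_sec k (\<lambda>x. F 4 x - 6 * (freq k)\<^sup>2 * F 2 x + 4 * freq k * G 3 x)
      (\<lambda>x. G 4 x - 4 * freq k * F 3 x - 4 * (freq k)\<^sup>2 * G 2 x - 4 * (freq k) ^ 4 * G 0 x) x"
    by (simp add: frame_sec_def m_def)
qed

section \<open>Eigensections as sums of waves\<close>

text \<open>The entries of the matrix by which \<open>I2 (phi k)\<close> acts on the coefficients \<open>(a, b)\<close> of \<open>wave k a b j\<close>.\<close>

definition symbol_tt :: "nat \<Rightarrow> int \<Rightarrow> real" where
  "symbol_tt k j = j ^ 4 + 6 * (freq k)\<^sup>2 * j\<^sup>2"

definition symbol_tn :: "nat \<Rightarrow> int \<Rightarrow> real" where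
  "symbol_tn k j = 4 * freq k * j ^ 3"

definition symbol_nn :: "nat \<Rightarrow> int \<Rightarrow> real" where
  "symbol_nn k j = j ^ 4 + 4 * (freq k)\<^sup>2 * j\<^sup>2 - 4 * (freq k) ^ 4"

text \<open>The opposite frequencies in the two coordinates make this plane of fields invariant: \<open>I2\<close> couples the
coordinates by odd derivatives, and these exchange \<open>cas (j x)\<close> and \<open>cas (- j x)\<close>.\<close>

definition wave :: "nat \<Rightarrow> real \<Rightarrow> real \<Rightarrow> int \<Rightarrow> real \<Rightarrow> real ^ 3" where
  "wave k a b j = frame_sec k (\<lambda>x. a * cas (j * x)) (\<lambda>x. b * cas (- j * x))"

lemma sum_wave:
  fixes a b c :: "int \<Rightarrow> real" and x :: real
  shows "(\<Sum>j\<in>J. c j *\<^sub>R wave k (a j) (b j) j x) =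
     frame_sec k (\<lambda>x. \<Sum>j\<in>J. c j * a j * cas (j * x)) (\<lambda>x. \<Sum>j\<in>J. c j * b j * cas (- j * x)) x"
  by (simp add: wave_def frame_sec_def frame_vec_def scaleR_add_right sum.distrib scaleR_sum_left mult.assoc)

text \<open>The Hartley coefficient of index \<open>i\<close> of the tangential coordinate, or of index \<open>- i\<close> of the normal one,
isolates \<open>c i\<close>.\<close>

lemma wave_independent:
  fixes a b c :: "int \<Rightarrow> real"
  assumes "finite J" and ab: "\<And>j. j \<in> J \<Longrightarrow> a j \<noteq> 0 \<or> b j \<noteq> 0"
    and zero: "\<And>x. (\<Sum>j\<in>J. c j *\<^sub>R wave k (a j) (b j) j x) = 0" and "i \<in> J"
  shows "c i = 0"
proof -
  have 0: "(\<Sum>j\<in>J. c j * a j * cas (j * x)) = 0" "(\<Sum>j\<in>J. c j * b j * cas (- j * x)) = 0" for x :: real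
  proof -
    have "frame_vec k x (\<Sum>j\<in>J. c j * a j * cas (j * x)) (\<Sum>j\<in>J. c j * b j * cas (- j * x)) = frame_vec k x 0 0"
      using zero[of x] unfolding sum_wave frame_sec_def by (simp add: frame_vec_def)
    then show "(\<Sum>j\<in>J. c j * a j * cas (j * x)) = 0" "(\<Sum>j\<in>J. c j * b j * cas (- j * x)) = 0"
      unfolding frame_vec_eq_iff by auto
  qed
  have "hartley (\<lambda>x. \<Sum>j\<in>J. c j * a j * cas (j * x)) i = 2 * pi * c i * a i"
  proof -
    have "hartley (\<lambda>x. \<Sum>j\<in>J. c j * a j * cas (j * x)) i = (\<Sum>j\<in>J. c j * a j * (if j = i then 2 * pi else 0))"
      by (subst hartley_sum) (auto intro!: continuous_intros simp: hartley_cmult hartley_cas)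
    also have "\<dots> = (\<Sum>j\<in>J. if j = i then c i * a i * (2 * pi) else 0)" by (rule sum.cong) auto
    finally show ?thesis using \<open>finite J\<close> \<open>i \<in> J\<close> by simp
  qed
  moreover have "hartley (\<lambda>x. \<Sum>j\<in>J. c j * b j * cas (- j * x)) (- i) = 2 * pi * c i * b i"
  proof -
    have "hartley (\<lambda>x. \<Sum>j\<in>J. c j * b j * cas (of_int (- j) * x)) (- i) = (\<Sum>j\<in>J. c j * b j * (if - j = - i then 2 * pi else 0))"
      by (subst hartley_sum) (auto intro!: continuous_intros simp only: hartley_cmult hartley_cas)
    also have "\<dots> = (\<Sum>j\<in>J. if j = i then c i * b i * (2 * pi) else 0)" by (rule sum.cong) auto
    finally show ?thesis using \<open>finite J\<close> \<open>i \<in> J\<close> by simp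
  qed
  ultimately show ?thesis using ab[OF \<open>i \<in> J\<close>] unfolding 0 by auto
qed

lemma I2_sum_wave:
  fixes a b c :: "int \<Rightarrow> real"
  shows "I2 (phi k) (\<lambda>x. \<Sum>j\<in>J. c j *\<^sub>R wave k (a j) (b j) j x) = 
   (\<lambda>x. \<Sum>j\<in>J. c j *\<^sub>R wave k (symbol_tt k j * a j + symbol_tn k j * b j)
                          (symbol_tn k j * a j + symbol_nn k j * b j) j x)"
proof -
  define F where "F n x = (\<Sum>j\<in>J. c j * a j * (of_int j ^ n * cas (j * x + n * (pi / 2))))" for n :: nat and x :: real
  define G where "G n x = (\<Sum>j\<in>J. c j * b j * (of_int (- j) ^ n * cas (of_int (- j) * x + n * (pi / 2))))" for n :: nat and x :: real
  have FG: "(F n has_real_derivative F (Suc n) x) (at x)" "(G n has_real_derivative G (Suc n) x) (at x)" for n x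
    unfolding F_def[abs_def] G_def[abs_def] by (intro DERIV_sum DERIV_cmult has_real_derivative_cas_iterated)+
  have V: "(\<lambda>x. \<Sum>j\<in>J. c j *\<^sub>R wave k (a j) (b j) j x) = frame_sec k (F 0) (G 0)"
    by (simp add: fun_eq_iff sum_wave frame_sec_def F_def G_def)
  have "F 4 x - 6 * (freq k)\<^sup>2 * F 2 x + 4 * freq k * G 3 x =
      (\<Sum>j\<in>J. c j * (symbol_tt k j * a j + symbol_tn k j * b j) * cas (j * x))" for x :: real
    unfolding F_def G_def cas_quarter_turns sum_distrib_left sum_subtractf[symmetric] sum.distrib[symmetric]
    by (rule sum.cong) (simp_all add: symbol_tt_def symbol_tn_def algebra_simps)
  moreover have "G 4 x - 4 * freq k * F 3 x - 4 * (freq k)\<^sup>2 * G 2 x - 4 * freq k ^ 4 * G 0 x =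
      (\<Sum>j\<in>J. c j * (symbol_tn k j * a j + symbol_nn k j * b j) * cas (- j * x))" for x :: real
    unfolding F_def G_def cas_quarter_turns sum_distrib_left sum_subtractf[symmetric] sum.distrib[symmetric]
    by (rule sum.cong) (simp_all add: symbol_tn_def symbol_nn_def algebra_simps)
  ultimately show ?thesis
    unfolding V I2_frame_sec[of F G, OF FG] by (simp add: fun_eq_iff sum_wave frame_sec_def)
qed

text \<open>The eigenvalue equation is a linear differential equation with constant coefficients for the coordinates
of the section; taking Hartley coefficients turns it into the eigenvector equation of the symbol
matrix at each frequency.\<close>

lemma eigenspace_hartley:
  assumes "V \<in> eigenspace (phi k) lam"
  obtains f g where "V = frame_sec k f g" "continuous_on UNIV f" "continuous_on UNIV g"
    "periodic f" "periodic g"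
    "\<And>j. symbol_tt k j * hartley f j + symbol_tn k j * hartley g (- j) = lam * hartley f j"
    "\<And>j. symbol_tn k j * hartley f j + symbol_nn k j * hartley g (- j) = lam * hartley g (- j)"
proof -
  have V: "smooth V" "periodic V" "\<And>x. V x \<bullet> phi k x = 0" "\<And>x. I2 (phi k) V x = lam *\<^sub>R V x"
    using assms by (auto simp: eigenspace_def sections_def)
  define f where "f x = V x \<bullet> tangent k x" for x
  define g where "g x = V x \<bullet> normal k x" for x
  have eq: "V = frame_sec k f g"
    using frame_expansion[OF V(3)] by (simp add: fun_eq_iff f_def g_def frame_sec_def frame_vec_def)
  have sm: "smooth f" "smooth g"
    unfolding f_def[abs_def] g_def[abs_def] by (intro smooth_inner V smooth_frame)+
  have per: "periodic f" "periodic g"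
    using V(2) periodic_frame[of k] by (simp_all add: periodic_def f_def g_def)
  obtain F where F: "F 0 = f" "\<And>n x. (F n has_real_derivative F (Suc n) x) (at x)"
    using smooth_derivatives[OF sm(1)] by blast
  obtain G where G: "G 0 = g" "\<And>n x. (G n has_real_derivative G (Suc n) x) (at x)"
    using smooth_derivatives[OF sm(2)] by blast
  have cont: "continuous_on UNIV (F n)" "continuous_on UNIV (G n)" for n
    using F(2) G(2) by (meson DERIV_continuous continuous_at_imp_continuous_on)+
  have "frame_vec k x (F 4 x - 6 * (freq k)\<^sup>2 * F 2 x + 4 * freq k * G 3 x)
      (G 4 x - 4 * freq k * F 3 x - 4 * (freq k)\<^sup>2 * G 2 x - 4 * (freq k) ^ 4 * G 0 x)
    = frame_vec k x (lam * F 0 x) (lam * G 0 x)" for x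
    using V(4)[of x] unfolding eq F(1)[symmetric] G(1)[symmetric] I2_frame_sec[of F G, OF F(2) G(2)]
    by (simp add: frame_sec_def frame_vec_simps)
  then have ode: "lam * F 0 x = F 4 x + (- 6 * (freq k)\<^sup>2) * F 2 x + (4 * freq k) * G 3 x"
    "lam * G 0 x = G 4 x + (- 4 * freq k) * F 3 x + (- 4 * (freq k)\<^sup>2) * G 2 x + (- 4 * (freq k) ^ 4) * G 0 x" for x
    unfolding frame_vec_eq_iff by (simp_all add: algebra_simps)
  have hF: "hartley (F 2) j = - (of_int j)\<^sup>2 * hartley f j"
     "hartley (F 3) j = of_int j ^ 3 * hartley f (- j)"
     "hartley (F 4) j = of_int j ^ 4 * hartley f j" for j
    using hartley_iterated_derivatives[of F, OF F(2)] per(1) by (simp_all add: F(1))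
  have hG: "hartley (G 2) j = - (of_int j)\<^sup>2 * hartley g j"
     "hartley (G 3) j = of_int j ^ 3 * hartley g (- j)"
     "hartley (G 4) j = of_int j ^ 4 * hartley g j" for j
    using hartley_iterated_derivatives[of G, OF G(2)] per(2) by (simp_all add: G(1))
  show ?thesis
  proof (rule that[OF eq _ _ per])
    show "continuous_on UNIV f" "continuous_on UNIV g" using cont[of 0] F(1) G(1) by auto
    fix j
    have "lam * hartley f j = hartley (\<lambda>x. F 4 x + (- 6 * (freq k)\<^sup>2) * F 2 x + (4 * freq k) * G 3 x) j"
      unfolding ode[symmetric] hartley_cmult F(1) ..
    also have "\<dots> = hartley (F 4) j + (- 6 * (freq k)\<^sup>2) * hartley (F 2) j + (4 * freq k) * hartley (G 3) j"
      by (simp only: hartley_add hartley_cmult continuous_on_add continuous_on_mult_left cont)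
    finally show "symbol_tt k j * hartley f j + symbol_tn k j * hartley g (- j) = lam * hartley f j"
      by (simp add: hF hG symbol_tt_def symbol_tn_def algebra_simps)
    have "lam * hartley g (- j) = hartley (\<lambda>x. G 4 x + (- 4 * freq k) * F 3 x + (- 4 * (freq k)\<^sup>2) * G 2 x + (- 4 * (freq k) ^ 4) * G 0 x) (- j)"
      by (simp only: ode(2)[symmetric] hartley_cmult) (simp only: G(1))
    also have "\<dots> = hartley (G 4) (- j) + (- 4 * freq k) * hartley (F 3) (- j) + (- 4 * (freq k)\<^sup>2) * hartley (G 2) (- j)
       + (- 4 * (freq k) ^ 4) * hartley (G 0) (- j)"
      by (simp only: hartley_add hartley_cmult continuous_on_add continuous_on_mult_left cont)
    finally show "symbol_tn k j * hartley f j + symbol_nn k j * hartley g (- j) = lam * hartley g (- j)"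
      by (simp add: hF hG G(1) symbol_tn_def symbol_nn_def algebra_simps)
  qed
qed

text \<open>At the frequencies in \<open>J\<close> the solutions of the eigenvector equation of the symbol matrix are the multiples of
\<open>(a j, b j)\<close>, elsewhere it has only the zero solution; hence an eigensection has finitely many nonzero
Hartley coefficients and is the finite sum of its waves.\<close>

lemma eigenspace_waves:
  fixes a b :: "int \<Rightarrow> real"
  assumes "finite J"
    and sol: "\<And>j. j \<in> J \<Longrightarrow> symbol_tt k j * a j + symbol_tn k j * b j = lam * a j"
       "\<And>j. j \<in> J \<Longrightarrow> symbol_tn k j * a j + symbol_nn k j * b j = lam * b j"
    and all: "\<And>j p q. j \<in> J \<Longrightarrow> symbol_tt k j * p + symbol_tn k j * q = lam * p \<Longrightarrow>
       symbol_tn k j * p + symbol_nn k j * q = lam * q \<Longrightarrow> \<exists>c. p = c * a j \<and> q = c * b j"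
    and none: "\<And>j p q. j \<notin> J \<Longrightarrow> symbol_tt k j * p + symbol_tn k j * q = lam * p \<Longrightarrow>
       symbol_tn k j * p + symbol_nn k j * q = lam * q \<Longrightarrow> p = 0 \<and> q = 0"
  shows "eigenspace (phi k) lam = {\<lambda>x. \<Sum>j\<in>J. c j *\<^sub>R wave k (a j) (b j) j x | c. True}"
proof (intro equalityI subsetI)
  fix V assume "V \<in> eigenspace (phi k) lam"
  then obtain f g where V: "V = frame_sec k f g" and cont: "continuous_on UNIV f" "continuous_on UNIV g"
    and per: "periodic f" "periodic g" and
    eqs: "\<And>j. symbol_tt k j * hartley f j + symbol_tn k j * hartley g (- j) = lam * hartley f j"
    "\<And>j. symbol_tn k j * hartley f j + symbol_nn k j * hartley g (- j) = lam * hartley g (- j)"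
    using eigenspace_hartley by metis
  have "\<exists>c. \<forall>j\<in>J. hartley f j = c j * a j \<and> hartley g (- j) = c j * b j"
    using all eqs by (intro bchoice) blast
  then obtain c where c: "\<And>j. j \<in> J \<Longrightarrow> hartley f j = c j * a j" "\<And>j. j \<in> J \<Longrightarrow> hartley g (- j) = c j * b j"
    by blast
  have zero: "hartley f j = 0 \<and> hartley g (- j) = 0" if "j \<notin> J" for j
    using none[OF that eqs] .
  have f: "f x = (\<Sum>j\<in>J. hartley f j / (2 * pi) * cas (j * x))" for x :: real
    by (rule hartley_expansion) (use cont per zero assms(1) in auto)
  \<comment> \<open>The normal coordinate carries the opposite frequencies.\<close>
  have "g x = (\<Sum>j\<in>uminus ` J. hartley g j / (2 * pi) * cas (j * x))" for x :: real
  proof (rule hartley_expansion)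
    fix j assume "j \<notin> uminus ` J"
    then have "- j \<notin> J" by (metis imageI minus_minus)
    then show "hartley g j = 0" using zero[of "- j"] by simp
  qed (use cont per assms(1) in auto)
  then have g: "g x = (\<Sum>j\<in>J. hartley g (- j) / (2 * pi) * cas (- j * x))" for x :: real
    by (simp add: sum.reindex inj_on_def)
  have "V = (\<lambda>x. \<Sum>j\<in>J. (c j / (2 * pi)) *\<^sub>R wave k (a j) (b j) j x)"
  proof
    fix x :: real
    have "f x = (\<Sum>j\<in>J. c j / (2 * pi) * a j * cas (j * x))"
      unfolding f[of x] by (rule sum.cong) (simp_all add: c)
    moreover have "g x = (\<Sum>j\<in>J. c j / (2 * pi) * b j * cas (- j * x))"
      unfolding g[of x] by (rule sum.cong) (simp_all add: c)
    ultimately show "V x = (\<Sum>j\<in>J. (c j / (2 * pi)) *\<^sub>R wave k (a j) (b j) j x)"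
      unfolding sum_wave V frame_sec_def by simp
  qed
  then show "V \<in> {\<lambda>x. \<Sum>j\<in>J. c j *\<^sub>R wave k (a j) (b j) j x | c. True}"
    by (intro CollectI exI[of _ "\<lambda>j. c j / (2 * pi)"]) simp
next
  fix V assume "V \<in> {\<lambda>x. \<Sum>j\<in>J. c j *\<^sub>R wave k (a j) (b j) j x | c. True}"
  then obtain c where V: "V = (\<lambda>x. \<Sum>j\<in>J. c j *\<^sub>R wave k (a j) (b j) j x)" by blast
  define f where "f x = (\<Sum>j\<in>J. c j * a j * cas (j * x))" for x :: real
  define g where "g x = (\<Sum>j\<in>J. c j * b j * cas (of_int (- j) * x))" for x :: real
  have Vfg: "V = frame_sec k f g" by (simp add: V sum_wave fun_eq_iff f_def g_def frame_sec_def)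
  have "smooth f" "smooth g"
    unfolding f_def[abs_def] g_def[abs_def] by (intro smooth_sum smooth_mult smooth_const smooth_cas)+
  then have "smooth V" unfolding Vfg by (rule smooth_frame_sec)
  moreover have "periodic f" "periodic g"
    using periodic_cas unfolding periodic_def f_def g_def by (simp_all del: of_int_minus)
  then have "periodic V"
    using periodic_frame[of k] by (simp add: Vfg periodic_def frame_sec_def frame_vec_def)
  moreover have "V x \<bullet> phi k x = 0" for x
    by (simp add: Vfg frame_sec_def frame_vec_coordinates)
  moreover have "I2 (phi k) V x = lam *\<^sub>R V x" for x
  proof -
    have "I2 (phi k) V x = (\<Sum>j\<in>J. c j *\<^sub>R wave k (lam * a j) (lam * b j) j x)"
      unfolding V I2_sum_wave by (rule sum.cong) (simp_all add: sol)
    also have "\<dots> = (\<Sum>j\<in>J. c j *\<^sub>R lam *\<^sub>R wave k (a j) (b j) j x)"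
      by (simp add: wave_def frame_sec_def frame_vec_simps mult.assoc)
    also have "\<dots> = lam *\<^sub>R V x" by (simp add: V scaleR_sum_right mult.commute)
    finally show ?thesis .
  qed
  ultimately show "V \<in> eigenspace (phi k) lam" by (simp add: eigenspace_def sections_def)
qed

section \<open>Spectrum of the symbol matrices\<close>

lemma freq_pos: "k \<ge> 1 \<Longrightarrow> freq k > 0"
  and freq_sq: "2 * (freq k)\<^sup>2 = (real k)\<^sup>2"
  by (simp_all add: freq_def power_divide)

definition lower_eigenvalue :: "nat \<Rightarrow> int \<Rightarrow> real" where
  "lower_eigenvalue k j = ((symbol_tt k j + symbol_nn k j) -
     sqrt ((symbol_tt k j - symbol_nn k j)\<^sup>2 + 4 * (symbol_tn k j)\<^sup>2)) / 2"

lemma symbol_tt_minus_nn: "symbol_tt k j - symbol_nn k j = 2 * (freq k)\<^sup>2 * (of_int j)\<^sup>2 + 4 * freq k ^ 4"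
  by (simp add: symbol_tt_def symbol_nn_def algebra_simps)

lemma lower_eigenvalue_char:
  "(symbol_tt k j - lower_eigenvalue k j) * (symbol_nn k j - lower_eigenvalue k j) = (symbol_tn k j)\<^sup>2"
proof -
  define s where "s = sqrt ((symbol_tt k j - symbol_nn k j)\<^sup>2 + 4 * (symbol_tn k j)\<^sup>2)"
  have "s\<^sup>2 = (symbol_tt k j - symbol_nn k j)\<^sup>2 + 4 * (symbol_tn k j)\<^sup>2"
    unfolding s_def by (intro real_sqrt_pow2) simp
  moreover have "s = symbol_tt k j + symbol_nn k j - 2 * lower_eigenvalue k j"
    unfolding lower_eigenvalue_def s_def[symmetric] by (simp add: field_simps)
  ultimately show ?thesis by (simp add: power2_eq_square algebra_simps)
qed

lemma lower_eigenvalue_less_tt: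
  assumes "k \<ge> 1" shows "lower_eigenvalue k j < symbol_tt k j"
proof -
  have "symbol_tt k j - symbol_nn k j > 0"
    using freq_pos[OF assms] by (simp add: symbol_tt_minus_nn add_nonneg_pos)
  moreover define s where "s = sqrt ((symbol_tt k j - symbol_nn k j)\<^sup>2 + 4 * (symbol_tn k j)\<^sup>2)"
  moreover have "s \<ge> 0" by (simp add: s_def)
  ultimately show ?thesis unfolding lower_eigenvalue_def s_def[symmetric] by simp
qed

text \<open>The larger root of the characteristic polynomial is at least the diagonal entry \<open>symbol_tt\<close>, so the bound
on \<open>lam\<close> selects the smaller root.\<close>

lemma lower_eigenvalue_unique:
  assumes "(symbol_tt k j - lam) * (symbol_nn k j - lam) = (symbol_tn k j)\<^sup>2" and "lam < symbol_tt k j"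
  shows "lam = lower_eigenvalue k j"
proof -
  have "symbol_nn k j - lam \<ge> 0"
    using assms by (metis diff_gt_0_iff_gt zero_le_mult_iff zero_le_power2 not_less)
  moreover have "(symbol_tt k j + symbol_nn k j - 2 * lam)\<^sup>2
      = (symbol_tt k j - symbol_nn k j)\<^sup>2 + 4 * (symbol_tn k j)\<^sup>2"
    unfolding assms(1)[symmetric] by (simp add: power2_eq_square algebra_simps)
  ultimately have "sqrt ((symbol_tt k j - symbol_nn k j)\<^sup>2 + 4 * (symbol_tn k j)\<^sup>2)
      = symbol_tt k j + symbol_nn k j - 2 * lam"
    using assms(2) by (intro real_sqrt_unique) auto
  then show ?thesis by (simp add: lower_eigenvalue_def)
qed

text \<open>This factorisation is where the frequency \<open>j = k\<close> is singled out; it uses \<open>2 (freq k)\<^sup>2 = k\<^sup>2\<close>.\<close>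

lemma symbol_det:
  "symbol_tt k j * symbol_nn k j - (symbol_tn k j)\<^sup>2 =
     (of_int j)\<^sup>2 * ((of_int j)\<^sup>2 - (real k)\<^sup>2) * (((of_int j)\<^sup>2 - (real k)\<^sup>2)\<^sup>2 + 2 * real k ^ 4)"
proof -
  \<comment> \<open>In terms of \<open>M\<close> both sides are polynomials in \<open>M\<close> and \<open>j\<close>, with \<open>k\<^sup>2 = 2 M\<close>.\<close>
  define M where "M = (freq k)\<^sup>2"
  have m: "freq k ^ 4 = M * M" "(symbol_tn k j)\<^sup>2 = 16 * M * of_int j ^ 6"
    by (simp_all add: M_def symbol_tn_def power_mult_distrib flip: power_mult power_add)
  have K: "(real k)\<^sup>2 = 2 * M" by (simp add: M_def freq_sq)
  have "real k ^ 4 = ((real k)\<^sup>2)\<^sup>2" by simp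
  then have K2: "real k ^ 4 = 4 * (M * M)" unfolding K by (simp add: power2_eq_square)
  show ?thesis
    unfolding m K K2 symbol_tt_def symbol_nn_def M_def[symmetric]
    by (simp add: eval_nat_numeral algebra_simps)
qed

text \<open>For \<open>j \<noteq> 0\<close> the other eigenvalue \<open>u\<close> is at least the positive entry \<open>symbol_tt\<close>, so the smaller eigenvalue has
the sign of the determinant.  For \<open>j = 0\<close> it is the negative diagonal entry.\<close>

lemma sgn_lower_eigenvalue:
  assumes "k \<ge> 1"
  shows "sgn (lower_eigenvalue k j) = sgn (\<bar>real_of_int j\<bar> - real k)"
proof (cases "j = 0")
  case True
  have "symbol_tt k j = 0" "symbol_tn k j = 0" "symbol_nn k j < 0"
    using True freq_pos[OF assms] by (simp_all add: symbol_tt_def symbol_tn_def symbol_nn_def)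
  then show ?thesis
    using lower_eigenvalue_less_tt[OF assms, of j] True assms by simp
next
  case False
  define l where "l = lower_eigenvalue k j"
  define u where "u = symbol_tt k j + symbol_nn k j - l"
  have "symbol_tt k j > 0"
    using False by (simp add: symbol_tt_def add_pos_nonneg)
  moreover have "u \<ge> symbol_tt k j"
  proof -
    have "0 \<le> (symbol_tt k j - l) * (symbol_nn k j - l)"
      using lower_eigenvalue_char[of k j] by (simp add: l_def)
    then show ?thesis
      using lower_eigenvalue_less_tt[OF assms, of j] by (simp add: l_def u_def zero_le_mult_iff)
  qed
  ultimately have "u > 0" by simp
  have "l * u = symbol_tt k j * symbol_nn k j - (symbol_tn k j)\<^sup>2"
    using lower_eigenvalue_char[of k j] unfolding u_def l_def[symmetric] by (simp add: algebra_simps)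
  also have "\<dots> = (\<bar>real_of_int j\<bar> - real k) *
      ((\<bar>real_of_int j\<bar> + real k) * (of_int j)\<^sup>2 * (((of_int j)\<^sup>2 - (real k)\<^sup>2)\<^sup>2 + 2 * real k ^ 4))"
  proof -
    have "(real_of_int j)\<^sup>2 - (real k)\<^sup>2 = (\<bar>real_of_int j\<bar> - real k) * (\<bar>real_of_int j\<bar> + real k)"
      by (simp add: algebra_simps power2_eq_square)
    then show ?thesis unfolding symbol_det by (simp add: mult_ac)
  qed
  finally have "sgn l * sgn u = sgn (\<bar>real_of_int j\<bar> - real k) *
      sgn ((\<bar>real_of_int j\<bar> + real k) * (of_int j)\<^sup>2 * (((of_int j)\<^sup>2 - (real k)\<^sup>2)\<^sup>2 + 2 * real k ^ 4))"
    by (metis sgn_mult)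
  moreover have "(\<bar>real_of_int j\<bar> + real k) * (of_int j)\<^sup>2 * (((of_int j)\<^sup>2 - (real k)\<^sup>2)\<^sup>2 + 2 * real k ^ 4) > 0"
    using False assms by (intro mult_pos_pos add_nonneg_pos) auto
  ultimately show ?thesis using \<open>u > 0\<close> by (simp add: l_def)
qed

lemma lower_eigenvalue_neg_iff: "k \<ge> 1 \<Longrightarrow> lower_eigenvalue k j < 0 \<longleftrightarrow> \<bar>j\<bar> < int k"
  and lower_eigenvalue_zero_iff: "k \<ge> 1 \<Longrightarrow> lower_eigenvalue k j = 0 \<longleftrightarrow> \<bar>j\<bar> = int k"
proof -
  assume "k \<ge> 1"
  note s = sgn_lower_eigenvalue[OF this, of j]
  have "lower_eigenvalue k j < 0 \<longleftrightarrow> \<bar>real_of_int j\<bar> - real k < 0"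
    using s by (metis sgn_less)
  also have "\<dots> \<longleftrightarrow> \<bar>j\<bar> < int k" by linarith
  finally show "lower_eigenvalue k j < 0 \<longleftrightarrow> \<bar>j\<bar> < int k" .
  have "lower_eigenvalue k j = 0 \<longleftrightarrow> \<bar>real_of_int j\<bar> - real k = 0"
    using s by (metis sgn_eq_0_iff)
  also have "\<dots> \<longleftrightarrow> \<bar>j\<bar> = int k" by linarith
  finally show "lower_eigenvalue k j = 0 \<longleftrightarrow> \<bar>j\<bar> = int k" .
qed

text \<open>This choice of eigenvector does not degenerate at \<open>j = 0\<close>, where the off-diagonal entry vanishes: the second
component \<open>symbol_tt - lam\<close> is positive for \<open>k \<ge> 1\<close>.\<close>

lemma lower_eigenvector:
  assumes "lam = lower_eigenvalue k j"
  shows "symbol_tt k j * (- symbol_tn k j) + symbol_tn k j * (symbol_tt k j - lam) = lam * (- symbol_tn k j)"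
    and "symbol_tn k j * (- symbol_tn k j) + symbol_nn k j * (symbol_tt k j - lam) = lam * (symbol_tt k j - lam)"
  using lower_eigenvalue_char[of k j] by (simp_all add: assms power2_eq_square algebra_simps)

text \<open>Below \<open>symbol_tt\<close> the first equation determines \<open>p\<close> from \<open>q\<close>, so eigenvectors lie on one line; a nonzero one
forces the characteristic equation.\<close>

lemma symbol_eigenvector:
  assumes eq: "symbol_tt k j * p + symbol_tn k j * q = lam * p"
      "symbol_tn k j * p + symbol_nn k j * q = lam * q"
    and lam: "lam < symbol_tt k j"
  shows "\<exists>c. p = c * (- symbol_tn k j) \<and> q = c * (symbol_tt k j - lam)"
    and "lam \<noteq> lower_eigenvalue k j \<Longrightarrow> p = 0 \<and> q = 0"
proof -
  define d where "d = symbol_tt k j - lam"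
  have "d > 0" using lam by (simp add: d_def)
  have p: "d * p = - symbol_tn k j * q" using eq(1) by (simp add: d_def algebra_simps)
  then have p': "p = (q / d) * (- symbol_tn k j)" using \<open>d > 0\<close> by (simp add: field_simps)
  moreover have "q = (q / d) * d" using \<open>d > 0\<close> by simp
  ultimately show "\<exists>c. p = c * (- symbol_tn k j) \<and> q = c * (symbol_tt k j - lam)"
    unfolding d_def by blast
  assume "lam \<noteq> lower_eigenvalue k j"
  then have ne: "(symbol_tt k j - lam) * (symbol_nn k j - lam) \<noteq> (symbol_tn k j)\<^sup>2"
    using lower_eigenvalue_unique lam by blast
  have "(d * (symbol_nn k j - lam) - (symbol_tn k j)\<^sup>2) * q = d * (symbol_nn k j * q - lam * q) + symbol_tn k j * (- symbol_tn k j * q)"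
    by (simp add: algebra_simps power2_eq_square)
  also have "\<dots> = d * (symbol_tn k j * p + symbol_nn k j * q - lam * q)"
    unfolding p[symmetric] by (simp add: algebra_simps)
  also have "\<dots> = 0" using eq(2) by simp
  finally have "q = 0" using ne by (simp add: d_def)
  then show "p = 0 \<and> q = 0" using p' by simp
qed

lemma symbol_tt_nonneg: "symbol_tt k j \<ge> 0"
  and symbol_tt_pos: "j \<noteq> 0 \<Longrightarrow> symbol_tt k j > 0"
  by (simp_all add: symbol_tt_def add_pos_nonneg)

section \<open>Nullity and index\<close>

lemma sum_fun_apply: "(\<Sum>j\<in>J. f j) x = (\<Sum>j\<in>J. f j x)"
  by (induction J rule: infinite_finite_induct) simp_all

text \<open>The family is indexed, not a set of functions; the independence hypothesis includes that its members
are distinct.\<close>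

lemma edim_basis:
  fixes W :: "'i \<Rightarrow> 'a \<Rightarrow> 'b::real_vector"
  assumes "finite J" and S: "S = {\<lambda>x. \<Sum>j\<in>J. c j *\<^sub>R W j x | c. True}"
    and indep: "\<And>c j. (\<And>x. (\<Sum>j\<in>J. c j *\<^sub>R W j x) = 0) \<Longrightarrow> j \<in> J \<Longrightarrow> c j = 0"
  shows "edim S = enat (card J)"
proof -
  have inj: "inj_on W J"
  proof (rule inj_onI, rule ccontr)
    fix i j assume ij: "i \<in> J" "j \<in> J" "W i = W j" "i \<noteq> j"
    \<comment> \<open>Equal functions at different indices would satisfy the relation with coefficients 1 and -1.\<close>
    define c :: "'i \<Rightarrow> real" where "c l = (if l = i then 1 else 0) - (if l = j then 1 else 0)" for l
    have "(\<Sum>l\<in>J. c l *\<^sub>R W l x) = 0" for x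
    proof -
      have "(\<Sum>l\<in>J. c l *\<^sub>R W l x) =
          (\<Sum>l\<in>J. if l = i then W i x else 0) - (\<Sum>l\<in>J. if l = j then W j x else 0)"
        unfolding sum_subtractf[symmetric] by (rule sum.cong) (auto simp: c_def)
      then show ?thesis using ij \<open>finite J\<close> by (simp add: sum.delta)
    qed
    from indep[of c i, OF this] ij show False by (simp add: c_def)
  qed
  have image: "(\<Sum>v\<in>W ` J. (\<lambda>x. u v *\<^sub>R v x)) = (\<lambda>x. \<Sum>j\<in>J. u (W j) *\<^sub>R W j x)" for u
    by (simp add: sum.reindex[OF inj] fun_eq_iff sum_fun_apply)
  have "fun_space.independent (W ` J)"
  proof (rule fun_space.independent_if_scalars_zero)
    fix u v assume "(\<Sum>v\<in>W ` J. (\<lambda>x. u v *\<^sub>R v x)) = 0" and "v \<in> W ` J"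
    then show "u v = 0" using indep[of "\<lambda>j. u (W j)"] unfolding image by (auto simp: fun_eq_iff)
  qed (use \<open>finite J\<close> in simp)
  moreover have "fun_space.span (W ` J) = S"
  proof -
    have "fun_space.span (W ` J) = range (\<lambda>u x. \<Sum>j\<in>J. u (W j) *\<^sub>R W j x)"
      using \<open>finite J\<close> by (simp add: fun_space.span_finite image)
    also have "\<dots> = S"
    proof (intro equalityI subsetI)
      fix V assume "V \<in> S"
      then obtain c where "V = (\<lambda>x. \<Sum>j\<in>J. c j *\<^sub>R W j x)" by (auto simp: S)
      also have "\<dots> = (\<lambda>x. \<Sum>j\<in>J. (c \<circ> inv_into J W) (W j) *\<^sub>R W j x)"
        by (auto simp: inv_into_f_f[OF inj] intro!: sum.cong ext)
      finally show "V \<in> range (\<lambda>u x. \<Sum>j\<in>J. u (W j) *\<^sub>R W j x)" by blast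
    qed (auto simp: S)
    finally show ?thesis .
  qed
  ultimately have "fun_space.dim S = card J"
    using fun_space.dim_span_eq_card_independent card_image[OF inj] by metis
  moreover have "\<exists>B. finite B \<and> S \<subseteq> fun_space.span B"
    using \<open>finite J\<close> \<open>fun_space.span (W ` J) = S\<close> by (intro exI[of _ "W ` J"]) auto
  ultimately show ?thesis by (simp add: edim_def)
qed

lemma edim_eigenspace:
  fixes a b :: "int \<Rightarrow> real"
  assumes "finite J"
    and "\<And>j. j \<in> J \<Longrightarrow> a j \<noteq> 0 \<or> b j \<noteq> 0"
    and "eigenspace (phi k) lam = {\<lambda>x. \<Sum>j\<in>J. c j *\<^sub>R wave k (a j) (b j) j x | c. True}"
  shows "edim (eigenspace (phi k) lam) = enat (card J)"
proof (rule edim_basis[OF assms(1,3)])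
  fix c j assume "\<And>x. (\<Sum>j\<in>J. c j *\<^sub>R wave k (a j) (b j) j x) = 0" and "j \<in> J"
  with assms(1,2) show "c j = 0" by (rule wave_independent)
qed

lemma finite_abs_int: "finite {j. \<bar>j\<bar> < int k}" "card {j. \<bar>j\<bar> < int k} = 2 * k - 1"
proof -
  have "{j. \<bar>j\<bar> < int k} = {- int k <..< int k}" by auto
  then show "finite {j. \<bar>j\<bar> < int k}" "card {j. \<bar>j\<bar> < int k} = 2 * k - 1" by simp_all
qed

text \<open>Different frequencies may share an eigenvalue, so the multiplicity of \<open>lam\<close> is the number of
frequencies that produce it.\<close>

lemma negative_eigenspace:
  assumes "k \<ge> 1" and "lam < 0"
  defines "J \<equiv> {j. lower_eigenvalue k j = lam}"
  shows "finite J" and "edim (eigenspace (phi k) lam) = enat (card J)"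
    and "eigenvalue (phi k) lam \<longleftrightarrow> J \<noteq> {}"
proof -
  have "J \<subseteq> {j. \<bar>j\<bar> < int k}"
    using lower_eigenvalue_neg_iff[OF assms(1)] assms(2) by (auto simp: J_def)
  then show fin: "finite J" using finite_abs_int(1) finite_subset by blast
  define a where "a j = - symbol_tn k j" for j
  define b where "b j = symbol_tt k j - lam" for j
  have less: "lam < symbol_tt k j" for j
    using assms(2) symbol_tt_nonneg[of k j] by linarith
  then have b: "b j \<noteq> 0" for j by (metis b_def diff_gt_0_iff_gt less_irrefl)
  have eig: "eigenspace (phi k) lam = {\<lambda>x. \<Sum>j\<in>J. c j *\<^sub>R wave k (a j) (b j) j x | c. True}"
  proof (rule eigenspace_waves[OF fin])
    fix j assume "j \<in> J"
    then show "symbol_tt k j * a j + symbol_tn k j * b j = lam * a j"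
       "symbol_tn k j * a j + symbol_nn k j * b j = lam * b j"
      using lower_eigenvector[of lam k j] by (auto simp: J_def a_def b_def)
  next
    fix j p q
    assume eq: "symbol_tt k j * p + symbol_tn k j * q = lam * p"
      "symbol_tn k j * p + symbol_nn k j * q = lam * q"
    show "\<exists>c. p = c * a j \<and> q = c * b j"
      unfolding a_def b_def by (rule symbol_eigenvector(1)[OF eq less])
    show "p = 0 \<and> q = 0" if "j \<notin> J"
      using that by (intro symbol_eigenvector(2)[OF eq less]) (auto simp: J_def)
  qed
  show "edim (eigenspace (phi k) lam) = enat (card J)"
    using fin b eig by (intro edim_eigenspace) auto
  show "eigenvalue (phi k) lam \<longleftrightarrow> J \<noteq> {}"
  proof
    assume "eigenvalue (phi k) lam"
    then show "J \<noteq> {}" unfolding eigenvalue_def eig by (auto split: if_splits)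
  next
    assume "J \<noteq> {}"
    then obtain i where i: "i \<in> J" by blast
    \<comment> \<open>Independence of the waves makes their sum a nonzero eigensection.\<close>
    define V where "V x = (\<Sum>j\<in>J. 1 *\<^sub>R wave k (a j) (b j) j x)" for x
    have "\<exists>x. V x \<noteq> 0"
      using wave_independent[OF fin _ _ i, of a b "\<lambda>j. 1"] b unfolding V_def by fastforce
    moreover have "V \<in> eigenspace (phi k) lam"
      unfolding eig V_def[abs_def] by (intro CollectI exI[of _ "\<lambda>j. 1"]) simp
    ultimately show "eigenvalue (phi k) lam" unfolding eigenvalue_def by blast
  qed
qed

text \<open>The constant multiples of the tangent field, at frequency 0, are null because the tangential entry of the
symbol vanishes there; this eigenvalue 0 is the larger one of that matrix, hence the separate choice of \<open>a\<close> and \<open>b\<close> at \<open>j = 0\<close>.\<close>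

lemma nullity_phi:
  assumes "k \<ge> 1" shows "Nullity (phi k) = 3"
proof -
  define J where "J = {- int k, 0, int k}"
  define a where "a j = (if j = 0 then 1 else - symbol_tn k j)" for j
  define b where "b j = (if j = 0 then 0 else symbol_tt k j)" for j
  have "eigenspace (phi k) 0 = {\<lambda>x. \<Sum>j\<in>J. c j *\<^sub>R wave k (a j) (b j) j x | c. True}"
  proof (rule eigenspace_waves)
    fix j assume "j \<in> J"
    then show "symbol_tt k j * a j + symbol_tn k j * b j = 0 * a j"
       "symbol_tn k j * a j + symbol_nn k j * b j = 0 * b j"
      using lower_eigenvector[of 0 k j] lower_eigenvalue_zero_iff[OF assms, of j]
      by (auto simp: J_def a_def b_def symbol_tt_def symbol_tn_def)
  next
    fix j p q
    assume eq: "symbol_tt k j * p + symbol_tn k j * q = 0 * p"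
      "symbol_tn k j * p + symbol_nn k j * q = 0 * q"
    show "\<exists>c. p = c * a j \<and> q = c * b j"
    proof (cases "j = 0")
      case True
      then have "q = 0" using eq(2) freq_pos[OF assms] by (simp add: symbol_tn_def symbol_nn_def)
      then show ?thesis using True by (simp add: a_def b_def)
    next
      case False
      then show ?thesis using symbol_eigenvector(1)[OF eq symbol_tt_pos] by (simp add: a_def b_def)
    qed
    show "p = 0 \<and> q = 0" if "j \<notin> J"
      using that lower_eigenvalue_zero_iff[OF assms, of j]
      by (intro symbol_eigenvector(2)[OF eq symbol_tt_pos]) (auto simp: J_def)
  qed (simp add: J_def)
  moreover have "a j \<noteq> 0 \<or> b j \<noteq> 0" for j
    using symbol_tt_pos[of j k] by (auto simp: a_def b_def)
  ultimately have "edim (eigenspace (phi k) 0) = enat (card J)"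
    by (intro edim_eigenspace) (auto simp: J_def)
  moreover have "card J = 3" using assms by (simp add: J_def)
  moreover have "eigenspace (phi k) 0 = {V \<in> sections (phi k). \<forall>\<gamma>. I2 (phi k) V \<gamma> = 0}"
    by (simp add: eigenspace_def)
  ultimately show ?thesis by (simp add: Nullity_def numeral_eq_enat)
qed

text \<open>Summing the multiplicities over the negative eigenvalues counts each frequency below \<open>k\<close> once.\<close>

lemma index_phi:
  assumes "k \<ge> 1" shows "Index (phi k) = enat (1 + 2 * (k - 1))"
proof -
  let ?N = "{j. \<bar>j\<bar> < int k}"
  let ?E = "{lam. eigenvalue (phi k) lam \<and> lam < 0}"
  have E: "?E = lower_eigenvalue k ` ?N"
    using negative_eigenspace(3)[OF assms] lower_eigenvalue_neg_iff[OF assms] by auto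
  then have fin: "finite ?E" using finite_abs_int(1) by simp
  have "Index (phi k) = (\<Sum>lam\<in>?E. edim (eigenspace (phi k) lam))"
    using fin by (simp add: Index_def)
  also have "\<dots> = (\<Sum>lam\<in>?E. enat (card {j \<in> ?N. lower_eigenvalue k j = lam}))"
  proof (rule sum.cong)
    fix lam assume "lam \<in> ?E"
    then have "lam < 0" by simp
    moreover from this have "{j \<in> ?N. lower_eigenvalue k j = lam} = {j. lower_eigenvalue k j = lam}"
      using lower_eigenvalue_neg_iff[OF assms] by auto
    ultimately show "edim (eigenspace (phi k) lam) = enat (card {j \<in> ?N. lower_eigenvalue k j = lam})"
      using negative_eigenspace(2)[OF assms] by simp
  qed simp
  also have "\<dots> = enat (\<Sum>lam\<in>?E. card {j \<in> ?N. lower_eigenvalue k j = lam})"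
    by (simp add: of_nat_eq_enat[symmetric])
  also have "(\<Sum>lam\<in>?E. card {j \<in> ?N. lower_eigenvalue k j = lam}) = card ?N"
    unfolding card_eq_sum by (rule sum.group) (use finite_abs_int(1) fin E in auto)
  also have "card ?N = 1 + 2 * (k - 1)" using assms finite_abs_int(2)[of k] by simp
  finally show ?thesis .
qed

theorem theorem1p7:
  fixes k :: nat
  assumes "k \<ge> 1"
  shows "proper_biharmonic (phi k) \<and> Nullity (phi k) = 3 \<and> Index (phi k) = enat (1 + 2 * (k - 1))"
proof -
  have "tension (phi k) 0 \<noteq> 0"
    using freq_pos[OF assms] frame_vec_coordinates(2)[of k 0 0 "- (freq k)\<^sup>2"]
    by (auto simp: tension_phi frame_sec_def)
  then show ?thesis
    using biharmonic_phi nullity_phi[OF assms] index_phi[OF assms] by (auto simp: proper_biharmonic_def)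
qed

end
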